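(* Let $f \colon \mathbb{R}^n\to\mathbb{R}$ be a continuous semi-algebraic function which is good at infinity. Assume that $S := \{x \in \mathbb{R}^n : f(x) \le 0 \} \ne \emptyset$. Then there exist some constants $c > 0$ and $\alpha > 0$ such that $$c\, d(x,S) \le [f(x)]_+^{\alpha} + [f(x)]_+ \quad \text{for all } x \in \mathbb{R}^n.$$
   Context: $d(x,S)$ denotes the Euclidean distance from $x$ to $S$; $[f(x)]_+ := \max\{f(x),0\}$. A subset of $\mathbb{R}^n$ is semi-algebraic if it is a finite union of sets defined by finitely many polynomial equations $g=0$ and strict inequalities $g>0$; a function is semi-algebraic if its graph is a semi-algebraic set. For a continuous function $f\colon\mathbb{R}^n\to\mathbb{R}$, the Fréchet subdifferential at $x$ is $$\hat\partial f(x) := \Big\{v\in\mathbb{R}^n : \liminf_{\|h\|\to 0,\ h\neq 0}\frac{f(x+h)-f(x)-\langle v,h\rangle}{\|h\|}\ge 0\Big\},$$ and the limiting subdifferential $\partial f(x)$ is the set of all cluster points of sequences $\{v^k\}_{k\ge1}$ such that $v^k\in\hat\partial f(x^k)$ and $(x^k,f(x^k))\to(x,f(x))$ as $k\to\infty$. The nonsmooth slope is $\mathfrak{m}_f(x) := \inf\{\|v\| : v\in\partial f(x)\}$, with $\mathfrak{m}_f(x)=+\infty$ if $\partial f(x)=\emptyset$. A continuous function $f$ is good at infinity if there exist constants $c>0$ and $R>0$ such that $\mathfrak{m}_f(x)\ge c$ for all $x\in f^{-1}((0,+\infty))$ with $\|x\|\ge R$. *)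

theory Defs
  imports "HOL-Analysis.Analysis"
begin

text \<open>On a Euclidean space, \<^const>\<open>real_polynomial_function\<close> is the algebra generated by the
  constants and the linear functionals, i.e. the polynomials in the coordinates.\<close>

definition basic_semialgebraic :: "'a::euclidean_space set \<Rightarrow> bool" where
  "basic_semialgebraic B \<longleftrightarrow>
    (\<exists>G H. finite G \<and> finite H \<and>
       (\<forall>g\<in>G. real_polynomial_function g) \<and> (\<forall>h\<in>H. real_polynomial_function h) \<and>
       B = {x. (\<forall>g\<in>G. g x = 0) \<and> (\<forall>h\<in>H. h x > 0)})"

definition semialgebraic :: "'a::euclidean_space set \<Rightarrow> bool" where
  "semialgebraic A \<longleftrightarrow> (\<exists>\<B>. finite \<B> \<and> (\<forall>B\<in>\<B>. basic_semialgebraic B) \<and> A = \<Union>\<B>)"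

definition semialgebraic_function :: "('a::euclidean_space \<Rightarrow> real) \<Rightarrow> bool" where
  "semialgebraic_function f \<longleftrightarrow> semialgebraic {(x, y). y = f x}"

text \<open>The lower limit is taken in the extended reals, as the quotient need not be bounded;
  the filter \<^term>\<open>at 0\<close> excludes \<open>h = 0\<close>.\<close>

definition frechet_subdifferential :: "('a::euclidean_space \<Rightarrow> real) \<Rightarrow> 'a \<Rightarrow> 'a set" where
  "frechet_subdifferential f x =
    {v. Liminf (at 0) (\<lambda>h. ereal ((f (x + h) - f x - v \<bullet> h) / norm h)) \<ge> 0}"

text \<open>A cluster point of a sequence is the limit of one of its subsequences.\<close>

definition limiting_subdifferential :: "('a::euclidean_space \<Rightarrow> real) \<Rightarrow> 'a \<Rightarrow> 'a set" where
  "limiting_subdifferential f x =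
    {w. \<exists>X V. (\<forall>k. V k \<in> frechet_subdifferential f (X k)) \<and>
              (\<lambda>k::nat. (X k, f (X k))) \<longlonglongrightarrow> (x, f x) \<and>
              (\<exists>r. strict_mono r \<and> (V \<circ> r) \<longlonglongrightarrow> w)}"

text \<open>The infimum over the empty set is \<open>\<infinity>\<close> in the extended reals.\<close>

definition nonsmooth_slope :: "('a::euclidean_space \<Rightarrow> real) \<Rightarrow> 'a \<Rightarrow> ereal" where
  "nonsmooth_slope f x = (INF v\<in>limiting_subdifferential f x. ereal (norm v))"

definition good_at_infinity :: "('a::euclidean_space \<Rightarrow> real) \<Rightarrow> bool" where
  "good_at_infinity f \<longleftrightarrow>
    (\<exists>c R. c > 0 \<and> R > 0 \<and>
       (\<forall>x. f x > 0 \<and> norm x \<ge> R \<longrightarrow> nonsmooth_slope f x \<ge> ereal c))"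

end

theory Submission
  imports Defs
begin

text \<open>
  The bound has a compact part and a part at infinity, and they are glued by one descent step.

  At infinity (\<open>descent_to_zero_set_or_ball\<close>), let \<open>f x > 0\<close> and minimise
  \<open>max (f z) 0 + l * sqrt (norm (z - x)\<^sup>2 + \<eta>\<^sup>2)\<close> over all \<open>z\<close>, where \<open>l\<close> lies below the lower
  bound \<open>c\<close> of the slope and \<open>\<eta> = f x / l\<close>. A minimiser \<open>y\<close> satisfies \<open>f y \<le> f x\<close> and lies within
  \<open>2 * f x / l\<close> of \<open>x\<close>. If \<open>f y > 0\<close> and \<open>norm y \<ge> R\<close>, the gradient of the smooth penalty
  would provide a Frechet subgradient of \<open>f\<close> at \<open>y\<close> of norm at most \<open>l < c\<close>, which is impossible. So from
  \<open>x\<close> one reaches, at a cost linear in \<open>f x\<close>, either \<open>S\<close> itself or the ball of radius \<open>R\<close>.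

  On a ball (\<open>error_bound_on_ball\<close>) the bound is a Lojasiewicz inequality. Consider the predicate
  \<open>\<Phi> (s, t)\<close>: some \<open>x\<close> in the ball has \<open>f x \<le> t\<close> and distance at least \<open>s\<close> to \<open>S\<close>. It is first-order
  over the semialgebraic graph of \<open>f\<close>, hence by quantifier elimination its truth depends only on the
  signs of finitely many polynomials in \<open>(s, t)\<close>. On a sufficiently thin horn
  \<open>0 < t < s ^ N\<close>, \<open>0 < s < e\<close>, every such sign is constant: writing the polynomial as a sum of terms
  \<open>a\<^sub>j s * t ^ j\<close>, the first nonzero \<open>a\<^sub>j\<close> decays like a power of \<open>s\<close> and dominates what follows.
  So \<open>\<Phi>\<close> is constant on a horn. It cannot be true there, because by compactness
  \<open>f\<close> has a positive minimum over the points of the ball at distance at least \<open>s\<close> from \<open>S\<close>.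
  Thus \<open>f x \<ge> (infdist x S) ^ N\<close> for every \<open>x\<close> in the ball that is outside \<open>S\<close> and close to it.

  Quantifier elimination is proved in a back-and-forth form (\<open>eliminable_param_polys\<close>): for finitely
  many polynomials in \<open>t\<close> whose coefficients are polynomials in a parameter \<open>x\<close>, there are
  finitely many polynomials in \<open>x\<close> such that any two parameters at which the latter have the same signs realise
  the same sign vectors of the former. As in the method of Cohen and Hormander, a polynomial \<open>p\<close> of highest
  degree is added to a family that is closed under derivatives and has remainders of \<open>p\<close> next to it. By
  Thom's lemma a realisable sign condition on a derivative-closed family defines a point or an open
  interval, the closure of which is obtained by relaxing the signs. The end points of an interval can
  therefore be recognised by signs alone, and they determine the signs that \<open>p\<close> takes inside
  (\<open>sign_condition_extension\<close>).
\<close>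

section \<open>Sign conditions on univariate real polynomials\<close>

lemma sgn_poly_eventually:
  fixes p :: "real poly"
  shows "\<exists>N. \<forall>s\<ge>N. sgn (poly p s) = sgn (lead_coeff p)"
proof (cases "lead_coeff p" "0::real" rule: linorder_cases)
  case greater
  then show ?thesis using poly_pinfty_gt_lc[of p]
    by (metis less_le_trans sgn_pos)
next
  case less
  then have "0 < lead_coeff (- p)" by simp
  from poly_pinfty_gt_lc[OF this] obtain N where N: "\<forall>x\<ge>N. lead_coeff (- p) \<le> poly (- p) x" by blast
  then have "\<forall>x\<ge>N. poly p x < 0" using less by fastforce
  then show ?thesis using less by (metis sgn_neg)
next
  case equal
  then show ?thesis by simp
qed

lemma sgn_coeff_eq_imp_degree_eq:
  fixes p q :: "real poly"
  assumes "\<And>n. sgn (coeff p n) = sgn (coeff q n)"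
  shows "degree p = degree q"
proof -
  have "coeff p n = 0 \<longleftrightarrow> coeff q n = 0" for n
    using assms[of n] by (metis sgn_0 sgn_0_0)
  then show ?thesis unfolding degree_def by simp
qed

lemma sgn_coeff_eq_imp_zero_iff:
  fixes p q :: "real poly"
  assumes "\<And>n. sgn (coeff p n) = sgn (coeff q n)"
  shows "p = 0 \<longleftrightarrow> q = 0"
  using assms by (metis poly_eq_iff coeff_0 sgn_0 sgn_0_0)

text \<open>
  The parameter \<open>d\<close> selects one of the two directions, so that arguments moving to the left and to the
  right of a point need not be given twice.
\<close>

lemma sgn_poly_ray_eventually:
  fixes p q :: "real poly"
  assumes c: "\<And>n. sgn (coeff p n) = sgn (coeff q n)" and d: "d = 1 \<or> d = -1"
  shows "\<exists>N. \<forall>s\<ge>N. sgn (poly p (a + d * s)) = sgn (poly q (b + d * s))"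
proof -
  let ?P = "pcompose p [:0, d:]" and ?Q = "pcompose q [:0, d:]"
  have cc: "sgn (coeff ?P n) = sgn (coeff ?Q n)" for n
    by (simp add: coeff_pcompose_linear sgn_mult c)
  have lc: "sgn (lead_coeff ?P) = sgn (lead_coeff ?Q)"
    using cc sgn_coeff_eq_imp_degree_eq[of ?P ?Q] by simp
  obtain N1 where N1: "\<forall>s\<ge>N1. sgn (poly ?P s) = sgn (lead_coeff ?P)"
    using sgn_poly_eventually by blast
  obtain N2 where N2: "\<forall>s\<ge>N2. sgn (poly ?Q s) = sgn (lead_coeff ?Q)"
    using sgn_poly_eventually by blast
  have e: "poly p (a + d * s) = poly ?P (d * a + s)" "poly q (b + d * s) = poly ?Q (d * b + s)" for s
    using d by (auto simp: poly_pcompose algebra_simps)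
  show ?thesis
    by (rule exI[of _ "max (N1 - d * a) (N2 - d * b)"]) (use N1 N2 lc in \<open>auto simp: e\<close>)
qed

lemma sgn_poly_segment:
  fixes p :: "real poly"
  assumes "\<And>x. x \<in> closed_segment a b \<Longrightarrow> poly p x \<noteq> 0"
  shows "sgn (poly p a) = sgn (poly p b)"
proof -
  have *: "sgn (poly p a) = sgn (poly p b)"
    if ab: "a < b" and nz: "\<And>x. a \<le> x \<Longrightarrow> x \<le> b \<Longrightarrow> poly p x \<noteq> 0" for a b
  proof (rule ccontr)
    assume ne: "sgn (poly p a) \<noteq> sgn (poly p b)"
    have "poly p a * poly p b < 0"
      using ne nz[of a] nz[of b] ab by (auto simp: sgn_if mult_less_0_iff split: if_splits)
    from poly_IVT[OF ab this] show False using nz by force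
  qed
  show ?thesis
  proof (cases a b rule: linorder_cases)
    case less then show ?thesis using *[of a b] assms by (simp add: closed_segment_eq_real_ivl)
  next
    case greater then show ?thesis using *[of b a] assms by (simp add: closed_segment_eq_real_ivl)
  qed simp
qed

lemma poly_MVT_segment:
  fixes p :: "real poly"
  assumes "a \<noteq> b"
  shows "\<exists>x\<in>open_segment a b. poly p b - poly p a = (b - a) * poly (pderiv p) x"
proof (cases "a < b")
  case True
  then show ?thesis using poly_MVT[of a b p] by (auto simp: open_segment_eq_real_ivl)
next
  case False
  then have "b < a" using assms by simp
  from poly_MVT[OF this, of p] obtain x where
    x: "b < x" "x < a" "poly p a - poly p b = (a - b) * poly (pderiv p) x" by blast
  then have "poly p b - poly p a = (b - a) * poly (pderiv p) x" by (simp add: algebra_simps)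
  then show ?thesis using x(1,2) by (intro bexI[of _ x]) (auto simp: open_segment_eq_real_ivl)
qed

text \<open>
  Thom's lemma. The sign condition that a derivative-closed family satisfies at \<open>b\<close> (a strict one, up
  to identically zero members) holds on the whole segment towards any point \<open>a\<close> that satisfies it in
  the relaxed sense, where some of the polynomials may vanish. The reason, by induction on the degree, is that
  the derivative keeps a strict sign in between, so the polynomial is strictly monotone there.
\<close>

lemma thom_segment:
  fixes v :: "'i \<Rightarrow> real poly"
  assumes der: "\<And>i. i \<in> I \<Longrightarrow> \<exists>j\<in>I. v j = pderiv (v i)"
    and b: "\<And>i. i \<in> I \<Longrightarrow> v i \<noteq> 0 \<Longrightarrow> poly (v i) b \<noteq> 0"
    and a: "\<And>i. i \<in> I \<Longrightarrow> sgn (poly (v i) a) \<in> {0, sgn (poly (v i) b)}"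
    and i: "i \<in> I" and s: "s \<in> open_segment a b"
  shows "sgn (poly (v i) s) = sgn (poly (v i) b)"
  using i s
proof (induction "degree (v i)" arbitrary: i s rule: less_induct)
  case less
  let ?p = "v i"
  obtain j where j: "j \<in> I" "v j = pderiv ?p" using der less.prems by blast
  show ?case
  proof (cases "degree ?p = 0")
    case True
    then obtain c where "?p = [:c:]" by (metis degree_eq_zeroE)
    then show ?thesis by simp
  next
    case False
    then have nz: "v j \<noteq> 0" using j by (simp add: pderiv_eq_0_iff)
    have dl: "degree (v j) < degree ?p" using j False by (simp add: degree_pderiv)
    have ab: "a \<noteq> b" using less.prems by auto
    have sne: "s \<noteq> a" "s \<noteq> b" using less.prems by (auto simp: open_segment_def)
    have sgj: "sgn (poly (pderiv ?p) x) = sgn (poly (v j) b)" if "x \<in> open_segment a b" for x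
      using less.hyps[OF dl j(1) that] j(2) by simp
    have ne0: "poly (v j) b \<noteq> 0" using b j nz by blast
    obtain x where x: "x \<in> open_segment a s" "poly ?p s - poly ?p a = (s - a) * poly (pderiv ?p) x"
      using poly_MVT_segment[of a s ?p] sne by auto
    obtain y where y: "y \<in> open_segment s b" "poly ?p b - poly ?p s = (b - s) * poly (pderiv ?p) y"
      using poly_MVT_segment[of s b ?p] sne by auto
    have "x \<in> open_segment a b" "y \<in> open_segment a b"
      using x y less.prems by (auto simp: open_segment_eq_real_ivl split: if_splits)
    then have "sgn (poly (pderiv ?p) x) = sgn (poly (v j) b)" "sgn (poly (pderiv ?p) y) = sgn (poly (v j) b)"
      using sgj by auto
    moreover have "sgn (s - a) = sgn (b - s)" "s - a \<noteq> 0"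
      using less.prems by (auto simp: open_segment_eq_real_ivl split: if_splits)
    ultimately have "sgn (poly ?p s - poly ?p a) = sgn (poly ?p b - poly ?p s)" "poly ?p s - poly ?p a \<noteq> 0"
      using x y ne0 by (auto simp: sgn_mult, (metis sgn_0_0)+)
    moreover have "poly ?p b \<noteq> 0" using b less.prems False by force
    ultimately show ?thesis using a[OF less.prems(1)]
      by (auto simp: sgn_if split: if_splits)
  qed
qed

text \<open>
  Two families \<open>u\<close> and \<open>v\<close> are compared; they stand for the same parametric polynomials at two values
  of the parameter. Let \<open>t\<close> and \<open>s\<close> satisfy the same sign condition, and let \<open>p\<close> be negative at \<open>t\<close>. Starting
  from \<open>t\<close>, walk in the direction in which \<open>p\<close> decreases. Either no root of the family is met, and then the signs at
  infinity, which are read off from the coefficients, decide; or the first root \<open>a\<close> is met, where \<open>p\<close>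
  is still negative. The point \<open>a'\<close> that corresponds to \<open>a\<close> lies in the closure of the cell of \<open>s\<close> by
  Thom's lemma, and by continuity \<open>q\<close> is negative at points of the cell near \<open>a'\<close>, whichever end
  of the cell \<open>a'\<close> is.
\<close>

lemma transfer_negative_value:
  fixes u v :: "'i \<Rightarrow> real poly" and p q :: "real poly"
  assumes fin: "finite I"
    and der: "\<And>i. i \<in> I \<Longrightarrow> \<exists>j\<in>I. v j = pderiv (v i)"
    and cuv: "\<And>i n. i \<in> I \<Longrightarrow> sgn (coeff (u i) n) = sgn (coeff (v i) n)"
    and cpq: "\<And>n. sgn (coeff p n) = sgn (coeff q n)"
    and root: "\<And>a i. i \<in> I \<Longrightarrow> u i \<noteq> 0 \<Longrightarrow> poly (u i) a = 0 \<Longrightarrow>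
       \<exists>a'. (\<forall>i\<in>I. sgn (poly (u i) a) = sgn (poly (v i) a')) \<and> sgn (poly p a) = sgn (poly q a')"
    and t: "\<And>i. i \<in> I \<Longrightarrow> u i \<noteq> 0 \<Longrightarrow> poly (u i) t \<noteq> 0"
    and s: "\<And>i. i \<in> I \<Longrightarrow> sgn (poly (u i) t) = sgn (poly (v i) s)"
    and j: "j \<in> I" "u j = pderiv p \<or> u j = - pderiv p" "pderiv p \<noteq> 0"
    and neg: "poly p t < 0"
  shows "\<exists>s'. (\<forall>i\<in>I. sgn (poly (u i) t) = sgn (poly (v i) s')) \<and> poly q s' < 0"
proof -
  have uv0: "u i = 0 \<longleftrightarrow> v i = 0" if "i \<in> I" for i
    using cuv[OF that] by (rule sgn_coeff_eq_imp_zero_iff)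
  have dt: "poly (pderiv p) t \<noteq> 0" using t[of j] j by auto
  define d where "d = - sgn (poly (pderiv p) t)"
  have d: "d = 1 \<or> d = -1" and d1: "d * sgn (poly (pderiv p) t) = -1" and dd: "d * d = 1"
    using dt by (auto simp: d_def sgn_if)
  \<comment> \<open>the parameters at which the ray from \<open>t\<close> in direction \<open>d\<close> meets a root of the family\<close>
  define Z where "Z = {b. b > 0 \<and> (\<exists>i\<in>I. u i \<noteq> 0 \<and> poly (u i) (t + d * b) = 0)}"
  have "Z \<subseteq> (\<lambda>x. d * (x - t)) ` (\<Union>i\<in>{i\<in>I. u i \<noteq> 0}. {x. poly (u i) x = 0})"
  proof
    fix b assume "b \<in> Z"
    then obtain i where "i \<in> I" "u i \<noteq> 0" "poly (u i) (t + d * b) = 0" unfolding Z_def by blast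
    moreover have "b = d * ((t + d * b) - t)" using dd by (simp add: algebra_simps flip: mult.assoc)
    ultimately show "b \<in> (\<lambda>x. d * (x - t)) ` (\<Union>i\<in>{i\<in>I. u i \<noteq> 0}. {x. poly (u i) x = 0})"
      by blast
  qed
  moreover have "finite (\<Union>i\<in>{i\<in>I. u i \<noteq> 0}. {x. poly (u i) x = 0})"
    using fin by (auto simp: poly_roots_finite)
  ultimately have finZ: "finite Z" by (meson finite_imageI finite_subset)
  have seg: "x \<in> closed_segment t (t + d * b) \<Longrightarrow> \<exists>c. 0 \<le> c \<and> c \<le> b \<and> x = t + d * c" if "0 \<le> b" for x b
    using that d by (auto simp: closed_segment_eq_real_ivl split: if_splits
        intro: exI[of _ "x - t"] exI[of _ "t - x"])
  have const: "sgn (poly (u i) (t + d * b)) = sgn (poly (u i) t)"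
    if "i \<in> I" "0 \<le> b" and bZ: "\<And>c. c \<in> Z \<Longrightarrow> b < c" for i b
  proof (cases "u i = 0")
    case False
    have "poly (u i) x \<noteq> 0" if x: "x \<in> closed_segment t (t + d * b)" for x
    proof
      assume z: "poly (u i) x = 0"
      obtain c where c: "0 \<le> c" "c \<le> b" "x = t + d * c" using seg[OF \<open>0 \<le> b\<close> x] by blast
      have "c \<noteq> 0" using z c t[OF \<open>i \<in> I\<close> False] by auto
      then have "c \<in> Z" unfolding Z_def using z c False \<open>i \<in> I\<close> by auto
      then show False using bZ[of c] c by force
    qed
    then show ?thesis using sgn_poly_segment[of t "t + d * b" "u i"] by simp
  qed simp
  have decr: "poly p (t + d * b) \<le> poly p t" if "0 \<le> b" "\<And>c. c \<in> Z \<Longrightarrow> b \<le> c" for b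
  proof (cases "b = 0")
    case False
    then have b: "0 < b" using that by simp
    then obtain x where x: "x \<in> open_segment t (t + d * b)"
      "poly p (t + d * b) - poly p t = (t + d * b - t) * poly (pderiv p) x"
      using poly_MVT_segment[of t "t + d * b" p] d by auto
    obtain c where c: "0 < c" "c < b" "x = t + d * c"
      using x(1) d b by (auto simp: open_segment_eq_real_ivl split: if_splits
        intro: that[of "x - t"] that[of "t - x"])
    have "sgn (poly (u j) x) = sgn (poly (u j) t)"
      using const[OF j(1), of c] c that(2) by fastforce
    then have "sgn (poly (pderiv p) x) = sgn (poly (pderiv p) t)" using j(2) by (auto simp: sgn_minus)
    then have "d * sgn (poly (pderiv p) x) = -1" using d1 by simp
    then have "d * poly (pderiv p) x < 0" using d by (auto simp: sgn_if split: if_splits)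
    then have "b * (d * poly (pderiv p) x) \<le> 0" using b mult_nonneg_nonpos[of b "d * poly (pderiv p) x"] by simp
    then show ?thesis using x(2) by (simp add: algebra_simps)
  qed simp
  show ?thesis
  proof (cases "Z = {}")
    case True
    have "\<exists>N. \<forall>x\<ge>N. sgn (poly (u i) (t + d * x)) = sgn (poly (v i) (0 + d * x))" if "i \<in> I" for i
      using sgn_poly_ray_eventually[OF cuv[OF that] d] by blast
    then obtain N where N: "\<And>i x. i \<in> I \<Longrightarrow> x \<ge> N i \<Longrightarrow> sgn (poly (u i) (t + d * x)) = sgn (poly (v i) (0 + d * x))"
      by metis
    obtain M where M: "\<And>x. x \<ge> M \<Longrightarrow> sgn (poly p (t + d * x)) = sgn (poly q (0 + d * x))"
      using sgn_poly_ray_eventually[OF cpq d] by blast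
    define x where "x = Max (insert 0 (insert M (N ` I)))"
    have x: "0 \<le> x" "M \<le> x" "\<And>i. i \<in> I \<Longrightarrow> N i \<le> x"
      unfolding x_def using fin by (auto intro!: Max_ge simp del: Max_insert)
    have "sgn (poly (u i) t) = sgn (poly (v i) (d * x))" if "i \<in> I" for i
      using N[OF that x(3)[OF that]] const[OF that x(1)] True by simp
    moreover have "poly p (t + d * x) < 0" using decr[OF x(1)] True neg by simp
    then have "poly q (d * x) < 0" using M[OF x(2)] by (auto simp: sgn_if split: if_splits)
    ultimately show ?thesis by blast
  next
    case False
    define b where "b = Min Z"
    have bZ: "b \<in> Z" and bmin: "\<And>c. c \<in> Z \<Longrightarrow> b \<le> c" unfolding b_def using finZ False by auto
    define a where "a = t + d * b"
    have b0: "0 < b" using bZ by (simp add: Z_def)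
    obtain i0 where i0: "i0 \<in> I" "u i0 \<noteq> 0" "poly (u i0) a = 0" using bZ by (auto simp: Z_def a_def)
    obtain a' where a': "\<And>i. i \<in> I \<Longrightarrow> sgn (poly (u i) a) = sgn (poly (v i) a')"
      and pa': "sgn (poly p a) = sgn (poly q a')" using root[OF i0] by blast
    have "poly p a < 0" using decr[of b] b0 bmin neg by (simp add: a_def)
    then have qa': "poly q a' < 0" using pa' by (auto simp: sgn_if split: if_splits)
    have ua: "sgn (poly (u i) a) \<in> {0, sgn (poly (u i) t)}" if i: "i \<in> I" for i
    proof (rule ccontr)
      assume ne: "sgn (poly (u i) a) \<notin> {0, sgn (poly (u i) t)}"
      then have ui: "u i \<noteq> 0" by auto
      have "poly (u i) t \<noteq> 0" using t[OF i ui] .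
      moreover have "poly (u i) a \<noteq> 0" using ne by auto
      moreover have "sgn (poly (u i) t) = sgn (poly (u i) a)"
      proof (rule sgn_poly_segment)
        fix x assume x: "x \<in> closed_segment t a"
        show "poly (u i) x \<noteq> 0"
        proof
          assume z: "poly (u i) x = 0"
          obtain c where c: "0 \<le> c" "c \<le> b" "x = t + d * c" using seg[of b x] x b0 by (auto simp: a_def)
          have "c \<noteq> 0" using z c t[OF i ui] by auto
          then have "c \<in> Z" unfolding Z_def using z c ui i by auto
          then have "c = b" using bmin c by force
          then show False using z c \<open>poly (u i) a \<noteq> 0\<close> by (simp add: a_def)
        qed
      qed
      ultimately show False using ne by simp
    qed
    have "a' \<noteq> s" using a'[OF i0(1)] s[OF i0(1)] i0 t[OF i0(1,2)] by (auto simp: sgn_0_0)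
    have cont: "isCont (poly q) a'" by simp
    then have "\<forall>\<^sub>F x in at a'. poly q x < 0"
      using qa' by (simp add: isCont_def order_tendstoD(2))
    then obtain e where e: "e > 0" "\<And>x. x \<noteq> a' \<Longrightarrow> dist x a' < e \<Longrightarrow> poly q x < 0"
      unfolding eventually_at by auto
    define s' where "s' = a' + (min (e/2) (\<bar>s - a'\<bar>/2)) * sgn (s - a')"
    have s'1: "s' \<in> open_segment a' s"
      using \<open>a' \<noteq> s\<close> e(1) unfolding s'_def
      by (auto simp: open_segment_eq_real_ivl sgn_if min_def field_simps split: if_splits)
    have "dist s' a' < e" "s' \<noteq> a'" using \<open>a' \<noteq> s\<close> e(1) unfolding s'_def dist_real_def
      by (auto simp: sgn_if min_def split: if_splits)
    then have "poly q s' < 0" using e by blast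
    moreover have "sgn (poly (u i) t) = sgn (poly (v i) s')" if "i \<in> I" for i
      unfolding s[OF that]
    proof (rule sym, rule thom_segment[where I = I and a = a' and b = s])
      show "\<And>i. i \<in> I \<Longrightarrow> \<exists>j\<in>I. v j = pderiv (v i)" by (rule der)
      show "poly (v i) s \<noteq> 0" if "i \<in> I" "v i \<noteq> 0" for i
        using that uv0 t[of i] s[of i] by (auto, metis sgn_0 sgn_0_0)
      show "sgn (poly (v i) a') \<in> {0, sgn (poly (v i) s)}" if "i \<in> I" for i
        using ua[OF that] a'[OF that] s[OF that] by simp
    qed (use that s'1 in auto)
    ultimately show ?thesis by blast
  qed
qed

text \<open>
  How the sign of one further polynomial is controlled. The hypothesis on roots is what
  the remainders modulo members of the family will supply. Away from roots, the cell of \<open>t\<close> is an open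
  interval on which \<open>p\<close> is constant or strictly monotone; in the latter case a zero of \<open>p\<close> has both
  signs next to it, both signs transfer by the previous lemma, and the intermediate value theorem
  gives a zero of \<open>q\<close> in the corresponding cell.
\<close>

lemma sign_condition_extension:
  fixes u v :: "'i \<Rightarrow> real poly" and p q :: "real poly"
  assumes fin: "finite I"
    and der: "\<And>i. i \<in> I \<Longrightarrow> \<exists>j\<in>I. v j = pderiv (v i)"
    and derp: "\<exists>j\<in>I. u j = pderiv p"
    and cuv: "\<And>i n. i \<in> I \<Longrightarrow> sgn (coeff (u i) n) = sgn (coeff (v i) n)"
    and cpq: "\<And>n. sgn (coeff p n) = sgn (coeff q n)"
    and root: "\<And>a i. i \<in> I \<Longrightarrow> u i \<noteq> 0 \<Longrightarrow> poly (u i) a = 0 \<Longrightarrow>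
       \<exists>a'. (\<forall>i\<in>I. sgn (poly (u i) a) = sgn (poly (v i) a')) \<and> sgn (poly p a) = sgn (poly q a')"
    and s: "\<exists>s. \<forall>i\<in>I. sgn (poly (u i) t) = sgn (poly (v i) s)"
  shows "\<exists>s. (\<forall>i\<in>I. sgn (poly (u i) t) = sgn (poly (v i) s)) \<and> sgn (poly p t) = sgn (poly q s)"
proof (cases "\<exists>i\<in>I. u i \<noteq> 0 \<and> poly (u i) t = 0")
  case True
  then show ?thesis using root by blast
next
  case False
  then have t: "\<And>i. i \<in> I \<Longrightarrow> u i \<noteq> 0 \<Longrightarrow> poly (u i) t \<noteq> 0" by blast
  obtain s where s: "\<And>i. i \<in> I \<Longrightarrow> sgn (poly (u i) t) = sgn (poly (v i) s)" using s by blast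
  obtain j where j: "j \<in> I" "u j = pderiv p" using derp by blast
  have uv0: "u i = 0 \<longleftrightarrow> v i = 0" if "i \<in> I" for i
    using cuv[OF that] by (rule sgn_coeff_eq_imp_zero_iff)
  let ?C = "\<lambda>t s. \<forall>i\<in>I. sgn (poly (u i) t) = sgn (poly (v i) s)"
  show ?thesis
  proof (cases "pderiv p = 0")
    case True
    then have "degree p = 0" by (simp add: pderiv_eq_0_iff)
    moreover have "degree q = 0" using sgn_coeff_eq_imp_degree_eq[OF cpq] \<open>degree p = 0\<close> by simp
    ultimately obtain c c' where "p = [:c:]" "q = [:c':]" by (metis degree_eq_zeroE)
    then show ?thesis using cpq[of 0] s by auto
  next
    case False
    \<comment> \<open>stated for \<open>(p, q)\<close> and \<open>(- p, - q)\<close> at once, to cover positive values too\<close>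
    have neg: "\<exists>s'. ?C t' s' \<and> poly p2 s' < 0"
      if t': "\<And>i. i \<in> I \<Longrightarrow> sgn (poly (u i) t') = sgn (poly (u i) t)" and p1: "poly p1 t' < 0"
        and pq: "p1 = p \<and> p2 = q \<or> p1 = - p \<and> p2 = - q" for t' p1 p2
    proof (rule transfer_negative_value[where v = v and p = p1 and s = s and j = j])
      show "\<exists>a'. (\<forall>i\<in>I. sgn (poly (u i) a) = sgn (poly (v i) a')) \<and> sgn (poly p1 a) = sgn (poly p2 a')"
        if "i \<in> I" "u i \<noteq> 0" "poly (u i) a = 0" for a i
        using root[OF that] pq by (auto simp: sgn_minus)
      show "sgn (coeff p1 n) = sgn (coeff p2 n)" for n
        using cpq[of n] pq by (auto simp: sgn_minus)
      show "poly (u i) t' \<noteq> 0" if "i \<in> I" "u i \<noteq> 0" for i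
        using t[OF that] t'[OF that(1)] by (metis sgn_0 sgn_0_0)
      show "sgn (poly (u i) t') = sgn (poly (v i) s)" if "i \<in> I" for i
        using s t' that by simp
      show "u j = pderiv p1 \<or> u j = - pderiv p1" "pderiv p1 \<noteq> 0"
        using j False pq by (auto simp: pderiv_minus)
    qed (use fin der cuv j p1 in auto)
    have pos: "\<exists>s'. ?C t' s' \<and> poly q s' > 0"
      if "\<And>i. i \<in> I \<Longrightarrow> sgn (poly (u i) t') = sgn (poly (u i) t)" "poly p t' > 0" for t'
      using neg[of t' "- p" "- q"] that by simp
    consider "poly p t < 0" | "poly p t > 0" | "poly p t = 0" by linarith
    then show ?thesis
    proof cases
      case 1
      then show ?thesis using neg[of t p q] by fastforce
    next
      case 2
      then show ?thesis using pos[of t] by fastforce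
    next
      case 3
      have "\<exists>e>0. \<forall>x. dist x t < e \<longrightarrow> (\<forall>i\<in>I. sgn (poly (u i) x) = sgn (poly (u i) t))"
      proof -
        have "\<forall>\<^sub>F x in nhds t. sgn (poly (u i) x) = sgn (poly (u i) t)" if "i \<in> I" for i
        proof (cases "u i = 0")
          case False
          then have nz: "poly (u i) t \<noteq> 0" using t that by blast
          have lim: "((poly (u i)) \<longlongrightarrow> poly (u i) t) (nhds t)"
            using poly_isCont[of t "u i"] by (simp add: continuous_at_imp_continuous_within tendsto_nhds_iff isCont_def)
          show ?thesis
          proof (cases "poly (u i) t > 0")
            case True
            then show ?thesis using order_tendstoD(1)[OF lim True] by (auto elim: eventually_mono)
          next
            case F: False
            then have "poly (u i) t < 0" using nz by simp
            then show ?thesis using order_tendstoD(2)[OF lim] by (fastforce elim: eventually_mono)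
          qed
        qed simp
        then have "\<forall>\<^sub>F x in nhds t. \<forall>i\<in>I. sgn (poly (u i) x) = sgn (poly (u i) t)"
          using fin by (simp add: eventually_ball_finite)
        then show ?thesis by (simp add: eventually_nhds_metric)
      qed
      then obtain e where e: "e > 0" "\<And>x i. dist x t < e \<Longrightarrow> i \<in> I \<Longrightarrow> sgn (poly (u i) x) = sgn (poly (u i) t)"
        by blast
      have mono: "\<exists>x. dist x t < e \<and> sgn (poly p x) = c" if c: "c = 1 \<or> c = -1" for c
      proof -
        define h where "h = e / 2 * (c * sgn (poly (pderiv p) t))"
        have dnz: "poly (pderiv p) t \<noteq> 0" using t[OF j(1)] j(2) False by simp
        have h: "\<bar>h\<bar> = e / 2" "h \<noteq> 0" using e(1) c dnz by (auto simp: h_def abs_mult sgn_if)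
        obtain x where x: "x \<in> open_segment t (t + h)"
          "poly p (t + h) - poly p t = (t + h - t) * poly (pderiv p) x"
          using poly_MVT_segment[of t "t + h" p] h by auto
        have "dist x t < e" using x(1) h e(1)
          by (auto simp: open_segment_eq_real_ivl dist_real_def split: if_splits)
        then have "sgn (poly (pderiv p) x) = sgn (poly (pderiv p) t)" using e(2)[of x j] j by simp
        moreover have "sgn h = c * sgn (poly (pderiv p) t)"
          using e(1) c dnz by (auto simp: h_def sgn_mult sgn_if)
        ultimately have "sgn (poly p (t + h)) = c"
          using x(2) 3 dnz by (auto simp: sgn_mult)
        moreover have "dist (t + h) t < e" using h e(1) by (simp add: dist_real_def)
        ultimately show ?thesis by blast
      qed
      obtain x1 where x1: "dist x1 t < e" "sgn (poly p x1) = -1" using mono[of "-1"] by auto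
      obtain x2 where x2: "dist x2 t < e" "sgn (poly p x2) = 1" using mono[of 1] by auto
      have "poly p x1 < 0" "poly p x2 > 0" using x1 x2 by (auto simp: sgn_if split: if_splits)
      then obtain s1 s2 where s12: "?C x1 s1" "poly q s1 < 0" "?C x2 s2" "poly q s2 > 0"
        using neg[of x1 p q] pos[of x2] e(2) x1 x2 by (metis (no_types))
      have "s1 \<noteq> s2" using s12 by auto
      have "\<exists>x\<in>open_segment s1 s2. poly q x = 0"
        using poly_IVT_pos[of s1 s2 q] poly_IVT_neg[of s2 s1 q] s12 \<open>s1 \<noteq> s2\<close>
        by (cases "s1 < s2") (force simp: open_segment_eq_real_ivl)+
      then obtain x where x: "x \<in> open_segment s1 s2" "poly q x = 0" by blast
      have C1: "sgn (poly (v i) s1) = sgn (poly (u i) t)" "sgn (poly (v i) s2) = sgn (poly (u i) t)" if "i \<in> I" for i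
        using s12 e(2)[OF _ that] x1 x2 that by force+
      have "sgn (poly (v i) x) = sgn (poly (v i) s2)" if "i \<in> I" for i
      proof (rule thom_segment[where I = I and a = s1 and b = s2])
        show "\<And>i. i \<in> I \<Longrightarrow> \<exists>j\<in>I. v j = pderiv (v i)" by (rule der)
        show "poly (v i) s2 \<noteq> 0" if "i \<in> I" "v i \<noteq> 0" for i
          using that uv0 t[of i] C1[of i] by (auto, metis sgn_0 sgn_0_0)
      qed (use that x C1 in auto)
      then show ?thesis using C1 x 3 by (intro exI[of _ x]) auto
    qed
  qed
qed

section \<open>Elimination of one real variable\<close>

definition same_signs :: "('a \<Rightarrow> real) set \<Rightarrow> 'a \<Rightarrow> 'a \<Rightarrow> bool" where
  "same_signs G x y \<longleftrightarrow> (\<forall>g\<in>G. sgn (g x) = sgn (g y))"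

lemma same_signs_Un: "same_signs (G \<union> H) x y \<longleftrightarrow> same_signs G x y \<and> same_signs H x y"
  by (auto simp: same_signs_def)

lemma same_signs_sym: "same_signs G x y \<Longrightarrow> same_signs G y x"
  by (auto simp: same_signs_def)

lemma same_signsD: "same_signs G x y \<Longrightarrow> g \<in> G \<Longrightarrow> sgn (g x) = sgn (g y)"
  by (simp add: same_signs_def)

text \<open>
  Polynomials in one variable of formal degree less than \<open>d\<close> with polynomial coefficients in a
  parameter. The actual degree of \<open>P x\<close> may drop for special values of \<open>x\<close>.
\<close>

definition param_polys :: "nat \<Rightarrow> ('a::real_normed_vector \<Rightarrow> real poly) set" where
  "param_polys d = {P. (\<forall>i. real_polynomial_function (\<lambda>x. coeff (P x) i)) \<and>
                       (\<forall>x. \<forall>i\<ge>d. coeff (P x) i = 0)}"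

definition param_pderiv :: "('a \<Rightarrow> real poly) \<Rightarrow> 'a \<Rightarrow> real poly" where
  "param_pderiv P = (\<lambda>x. pderiv (P x))"

text \<open>
  One step of pseudo-division of \<open>p\<close>, of formal degree \<open>d\<close>, by the truncation of \<open>q\<close> to degree \<open>j\<close>. The
  leading coefficient of the divisor enters squared, so that at a root of the divisor the result has the
  same sign as \<open>p\<close>. A single step suffices: the degree only has to drop below that of \<open>p\<close>. All
  truncations of \<open>q\<close> are used, since its actual degree depends on the parameter.
\<close>

definition param_reduce :: "nat \<Rightarrow> ('a \<Rightarrow> real poly) \<Rightarrow> ('a \<Rightarrow> real poly) \<Rightarrow> nat \<Rightarrow> 'a \<Rightarrow> real poly" where
  "param_reduce d p q j = (\<lambda>x. smult ((coeff (q x) j)\<^sup>2) (p x) -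
     monom (coeff (q x) j * coeff (p x) d) (d - j) * poly_cutoff (Suc j) (q x))"

lemma param_polys_mono: "d \<le> e \<Longrightarrow> param_polys d \<subseteq> param_polys e"
  by (auto simp: param_polys_def)

lemma param_pderiv_in: "P \<in> param_polys (Suc d) \<Longrightarrow> param_pderiv P \<in> param_polys d"
  unfolding param_polys_def param_pderiv_def by (auto simp: coeff_pderiv)

lemma param_pderiv_funpow_in:
  "P \<in> param_polys d \<Longrightarrow> (param_pderiv ^^ k) P \<in> param_polys (d - k)"
proof (induction k)
  case (Suc k)
  then have IH: "(param_pderiv ^^ k) P \<in> param_polys (d - k)" by blast
  show ?case
  proof (cases "d - k")
    case 0
    then have "(param_pderiv ^^ k) P \<in> param_polys (Suc 0)"
      using IH param_polys_mono[of 0 "Suc 0"] by auto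
    then show ?thesis using 0 param_pderiv_in[of "(param_pderiv ^^ k) P" 0] by simp
  next
    case (Suc m)
    then have "d - Suc k = m" by simp
    then show ?thesis using IH Suc param_pderiv_in[of "(param_pderiv ^^ k) P" m] by simp
  qed
qed simp

lemma param_polys_0: "P \<in> param_polys 0 \<Longrightarrow> P = (\<lambda>x. 0)"
  by (auto simp: param_polys_def poly_eq_iff)

lemma param_cutoff_in:
  assumes "P \<in> param_polys e"
  shows "(\<lambda>x. poly_cutoff d (P x)) \<in> param_polys d"
proof -
  have "real_polynomial_function (\<lambda>x. if i < d then coeff (P x) i else 0)" for i
    using assms by (cases "i < d") (auto simp: param_polys_def intro: real_polynomial_function.intros(2))
  then show ?thesis by (simp add: param_polys_def coeff_poly_cutoff)
qed

lemma param_reduce_in: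
  assumes p: "p \<in> param_polys (Suc d)" and q: "q \<in> param_polys e" and j: "j \<le> d"
  shows "param_reduce d p q j \<in> param_polys d"
proof -
  have rp: "real_polynomial_function (\<lambda>x. coeff (p x) i)" "real_polynomial_function (\<lambda>x. coeff (q x) i)" for i
    using p q by (auto simp: param_polys_def)
  have "real_polynomial_function (\<lambda>x. coeff (param_reduce d p q j x) n)" for n
    unfolding param_reduce_def
    by (cases "n < d - j"; cases "n - (d - j) < Suc j")
       (auto simp: coeff_monom_mult coeff_poly_cutoff intro!: rp real_polynomial_function_diff
        real_polynomial_function.intros(4) real_polynomial_function_power)
  moreover have "coeff (param_reduce d p q j x) n = 0" if "n \<ge> d" for n x
  proof (cases "n = d")
    case True
    then show ?thesis using j
      by (simp add: param_reduce_def coeff_monom_mult coeff_poly_cutoff power2_eq_square)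
  next
    case False
    then have "n \<ge> Suc d" using that by simp
    then have "coeff (p x) n = 0" using p by (simp add: param_polys_def)
    then show ?thesis using j \<open>n \<ge> Suc d\<close>
      by (simp add: param_reduce_def coeff_monom_mult coeff_poly_cutoff)
  qed
  ultimately show ?thesis by (simp add: param_polys_def)
qed

text \<open>
  The sign vectors that the family takes on the line over \<open>x\<close> depend only on the signs of finitely many
  polynomials at \<open>x\<close>. Matching single points \<open>t\<close> and \<open>s\<close> is weaker than matching the two lines by an order
  isomorphism, but it is all that an existential quantifier over \<open>t\<close> observes.
\<close>

definition eliminable :: "('a::real_normed_vector \<Rightarrow> real poly) set \<Rightarrow> bool" where
  "eliminable F \<longleftrightarrow> (\<exists>G. finite G \<and> (\<forall>g\<in>G. real_polynomial_function g) \<and>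
     (\<forall>x y. same_signs G x y \<longrightarrow>
        (\<forall>t. \<exists>s. \<forall>P\<in>F. sgn (poly (P x) t) = sgn (poly (P y) s))))"

text \<open>
  The induction step: a polynomial \<open>p\<close> of top degree is traded for polynomials of lower degree. The
  family is first closed under derivatives, which adds only polynomials of lower degree, and then the
  reductions of \<open>p\<close> are added; the given elimination result applies to what remains after removing \<open>p\<close>. Where
  the leading coefficient of \<open>p\<close> vanishes, \<open>p\<close> is replaced by its truncation instead.
\<close>

lemma eliminable_insert:
  fixes p :: "'a::real_normed_vector \<Rightarrow> real poly"
  assumes p: "p \<in> param_polys (Suc d)" and T: "T \<subseteq> param_polys (Suc d)" "finite T"
    and IH: "\<And>L. finite L \<Longrightarrow> L \<subseteq> param_polys d \<Longrightarrow> eliminable (T \<union> L)"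
    and L: "L \<subseteq> param_polys d" "finite L"
  shows "eliminable (insert p T \<union> L)"
proof -
  let ?D = param_pderiv
  \<comment> \<open>\<open>d\<close> derivatives annihilate everything of formal degree less than \<open>d\<close>\<close>
  define L' where "L' = (\<Union>k\<le>d. (?D ^^ k) ` (L \<union> ?D ` (insert p T)))"
  define E where "E = T \<union> L'"
  have LD: "L \<union> ?D ` (insert p T) \<subseteq> param_polys d"
    using L p T param_pderiv_in by blast
  have "(?D ^^ k) R \<in> param_polys d" if "R \<in> L \<union> ?D ` (insert p T)" for k R
    using param_pderiv_funpow_in[of R d k] param_polys_mono[of "d - k" d] LD that by auto
  then have L': "L' \<subseteq> param_polys d" "finite L'"
    using L T unfolding L'_def by blast+
  have "L \<union> ?D ` (insert p T) = (?D ^^ 0) ` (L \<union> ?D ` (insert p T))" by simp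
  then have L'0: "L \<union> ?D ` (insert p T) \<subseteq> L'" unfolding L'_def by blast
  have E: "E \<subseteq> param_polys (Suc d)" "finite E"
    using T L' param_polys_mono[of d "Suc d"] by (auto simp: E_def)
  have closed: "?D Q \<in> E" if "Q \<in> E" for Q
  proof (cases "Q \<in> T")
    case True
    then show ?thesis using L'0 unfolding E_def by blast
  next
    case False
    then have "Q \<in> L'" using that by (simp add: E_def)
    then obtain k R where k: "k \<le> d" "R \<in> L \<union> ?D ` (insert p T)" "Q = (?D ^^ k) R"
      unfolding L'_def by (elim UN_E imageE) auto
    show ?thesis
    proof (cases "k = d")
      case True
      then have "Q = (\<lambda>x. 0)" using k LD param_pderiv_funpow_in[of R d d] param_polys_0 by auto
      then have "?D Q = Q" by (simp add: param_pderiv_def)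
      then show ?thesis using that by simp
    next
      case False
      then have "?D Q = (?D ^^ Suc k) R" "Suc k \<le> d" using k by auto
      then have "?D Q \<in> (?D ^^ Suc k) ` (L \<union> ?D ` (insert p T))" using k(2) by blast
      then show ?thesis using \<open>Suc k \<le> d\<close> unfolding E_def L'_def by blast
    qed
  qed
  define Red where "Red = (\<lambda>(q, j). param_reduce d p q j) ` (E \<times> {..d})"
  have Red: "Red \<subseteq> param_polys d" "finite Red"
    using param_reduce_in[OF p] E by (auto simp: Red_def)
  obtain G1 where G1: "finite G1" "\<forall>g\<in>G1. real_polynomial_function g"
    "\<And>x y t. same_signs G1 x y \<Longrightarrow> \<exists>s. \<forall>P\<in>T \<union> (L' \<union> Red). sgn (poly (P x) t) = sgn (poly (P y) s)"
    using IH[of "L' \<union> Red"] L' Red unfolding eliminable_def by auto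
  obtain G2 where G2: "finite G2" "\<forall>g\<in>G2. real_polynomial_function g"
    "\<And>x y t. same_signs G2 x y \<Longrightarrow>
      \<exists>s. \<forall>P\<in>T \<union> (insert (\<lambda>x. poly_cutoff d (p x)) L). sgn (poly (P x) t) = sgn (poly (P y) s)"
    using IH[of "insert (\<lambda>x. poly_cutoff d (p x)) L"] L param_cutoff_in[OF p, of d]
    unfolding eliminable_def by auto
  define G3 where "G3 = (\<lambda>(q, i) x. coeff (q x) i) ` (insert p E \<times> {..d})"
  have G3: "finite G3" "\<forall>g\<in>G3. real_polynomial_function g"
    using E p by (auto simp: G3_def param_polys_def)
  have "\<exists>s. \<forall>P\<in>insert p T \<union> L. sgn (poly (P x) t) = sgn (poly (P y) s)"
    if xy: "same_signs (G1 \<union> G2 \<union> G3) x y" for x y t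
  proof -
    have c: "sgn (coeff (q x) n) = sgn (coeff (q y) n)" if "q \<in> insert p E" for q n
    proof (cases "n \<le> d")
      case True
      then have "(\<lambda>x. coeff (q x) n) \<in> G3" using that unfolding G3_def by force
      then show ?thesis using same_signsD[OF xy, of "\<lambda>x. coeff (q x) n"] by simp
    next
      case False
      then show ?thesis using that E p by (force simp: param_polys_def)
    qed
    have deg: "degree (q x) = degree (q y)" if "q \<in> insert p E" for q
      using c[OF that] sgn_coeff_eq_imp_degree_eq by blast
    show ?thesis
    proof (cases "coeff (p x) d = 0")
      case True
      then have "coeff (p y) d = 0" using c[of p d] by (simp add: sgn_0_0)
      have cut: "poly_cutoff d (p z) = p z" if "coeff (p z) d = 0" for z
        using p that by (auto simp: poly_eq_iff coeff_poly_cutoff param_polys_def)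
          (metis Suc_leI not_less order_le_less)
      show ?thesis
        using G2(3)[of x y t] xy cut[OF True] cut[OF \<open>coeff (p y) d = 0\<close>] by (auto simp: same_signs_Un)
    next
      case False
      have "\<exists>s. (\<forall>q\<in>E. sgn (poly (q x) t) = sgn (poly (q y) s)) \<and> sgn (poly (p x) t) = sgn (poly (p y) s)"
      proof (rule sign_condition_extension)
        show "finite E" by fact
        show "\<exists>j\<in>E. j y = pderiv (i y)" if "i \<in> E" for i
          using closed[OF that] by (auto simp: param_pderiv_def)
        show "\<exists>j\<in>E. j x = pderiv (p x)"
          using L'0 by (auto simp: param_pderiv_def E_def)
        show "\<And>n. sgn (coeff (p x) n) = sgn (coeff (p y) n)" using c[of p] by simp
        show "\<And>i n. i \<in> E \<Longrightarrow> sgn (coeff (i x) n) = sgn (coeff (i y) n)" using c by simp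
        show "\<exists>s. \<forall>i\<in>E. sgn (poly (i x) t) = sgn (poly (i y) s)"
          using G1(3)[of x y t] xy by (auto simp: same_signs_Un E_def)
        show "\<exists>a'. (\<forall>i\<in>E. sgn (poly (i x) a) = sgn (poly (i y) a')) \<and> sgn (poly (p x) a) = sgn (poly (p y) a')"
          if q: "q \<in> E" "q x \<noteq> 0" "poly (q x) a = 0" for a q
        proof -
          obtain a' where a': "\<And>P. P \<in> T \<union> (L' \<union> Red) \<Longrightarrow> sgn (poly (P x) a) = sgn (poly (P y) a')"
            using G1(3)[of x y a] xy by (auto simp: same_signs_Un)
          let ?j = "degree (q x)"
          have j: "?j \<le> d" using q(1) E(1) by (intro degree_le) (auto simp: param_polys_def)
          have red: "sgn (poly (param_reduce d p q ?j z) b) = sgn (poly (p z) b)"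
            if "poly (q z) b = 0" "degree (q z) = ?j" "q z \<noteq> 0" for z b
          proof -
            have "poly_cutoff (Suc ?j) (q z) = q z"
              using that(2) by (auto simp: poly_eq_iff coeff_poly_cutoff coeff_eq_0)
            moreover have "coeff (q z) ?j \<noteq> 0" using that by (metis leading_coeff_0_iff)
            ultimately show ?thesis using that(1)
              by (auto simp: param_reduce_def sgn_mult) (auto simp: sgn_if split: if_splits)
          qed
          have "param_reduce d p q ?j \<in> Red" using q j by (auto simp: Red_def)
          then have "sgn (poly (param_reduce d p q ?j x) a) = sgn (poly (param_reduce d p q ?j y) a')"
            using a' by blast
          moreover have "poly (q y) a' = 0" using a'[of q] q by (auto simp: E_def sgn_0_0)
          moreover have "q y \<noteq> 0" using sgn_coeff_eq_imp_zero_iff[OF c[of q]] q by auto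
          moreover have "degree (q y) = ?j" using deg q by auto
          ultimately have "sgn (poly (p x) a) = sgn (poly (p y) a')"
            using red[of x a] red[of y a'] q by simp
          then show ?thesis using a' by (auto simp: E_def)
        qed
      qed
      then show ?thesis using L'0 by (auto simp: E_def)
    qed
  qed
  then have "\<forall>x y. same_signs (G1 \<union> G2 \<union> G3) x y \<longrightarrow>
      (\<forall>t. \<exists>s. \<forall>P\<in>insert p T \<union> L. sgn (poly (P x) t) = sgn (poly (P y) s))" by blast
  moreover have "finite (G1 \<union> G2 \<union> G3)" "\<forall>g\<in>G1 \<union> G2 \<union> G3. real_polynomial_function g"
    using G1(1,2) G2(1,2) G3 by blast+
  ultimately show ?thesis
    unfolding eliminable_def by (intro exI[of _ "G1 \<union> G2 \<union> G3"] conjI)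
qed

text \<open>
  The outer induction is on the degree, the inner one on the number of polynomials of top degree; the
  number of polynomials of lower degree is left arbitrary because it grows in each step.
\<close>

theorem eliminable_param_polys:
  assumes "finite F" "F \<subseteq> param_polys d"
  shows "eliminable F"
  using assms
proof (induction d arbitrary: F)
  case 0
  then have "poly (P x) t = 0" if "P \<in> F" for P x t using param_polys_0 that by force
  then show ?case unfolding eliminable_def by (intro exI[of _ "{}"]) auto
next
  case (Suc d)
  have "\<forall>L. finite L \<longrightarrow> L \<subseteq> param_polys d \<longrightarrow> eliminable (F \<union> L)"
    using Suc.prems
  proof (induction F rule: finite_induct)
    case empty
    then show ?case using Suc.IH by simp
  next
    case (insert p T)
    then show ?case using eliminable_insert[of p d T] by simp
  qed
  from this[rule_format, of "{}"] show ?case by simp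
qed

lemma real_polynomial_function_as_param_poly:
  fixes g :: "'a::real_normed_vector \<times> real \<Rightarrow> real"
  assumes "real_polynomial_function g"
  shows "\<exists>d. \<exists>P\<in>param_polys d. \<forall>x t. g (x, t) = poly (P x) t"
  using assms
proof (induction g rule: real_polynomial_function.induct)
  case (linear f)
  note bl = this
  interpret bounded_linear f by fact
  have "f (x, t) = poly [:f (x, 0), f (0, 1):] t" for x t
    using add[of "(x, 0)" "(0, t)"] scaleR[of t "(0, 1)"] by simp
  then have "\<forall>x t. f (x, t) = poly [:f (x, 0), f (0, 1):] t" by blast
  moreover have "bounded_linear (\<lambda>x. f (x, 0))"
    by (intro bounded_linear_compose[OF bl] bounded_linear_Pair bounded_linear_ident bounded_linear_zero)
  then have "real_polynomial_function (\<lambda>x. coeff [:f (x, 0), f (0, 1):] i)" for i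
    by (cases i; cases "i - 1") (auto intro: real_polynomial_function.intros(1,2))
  then have "(\<lambda>x. [:f (x, 0), f (0, 1):]) \<in> param_polys 2"
    by (auto simp: param_polys_def coeff_pCons split: nat.splits)
  ultimately show ?case by (intro exI[of _ 2] bexI[of _ "\<lambda>x. [:f (x, 0), f (0, 1):]"])
next
  case (const c)
  have "real_polynomial_function (\<lambda>x. coeff [:c:] i)" for i
    by (rule real_polynomial_function.intros(2))
  then have "(\<lambda>x. [:c:]) \<in> param_polys 1"
    by (auto simp: param_polys_def coeff_eq_0)
  then show ?case by (intro exI[of _ 1] bexI[of _ "\<lambda>x. [:c:]"]) auto
next
  case (add f g)
  from add.IH(1) obtain d P where P: "P \<in> param_polys d" "\<forall>x t. f (x, t) = poly (P x) t"
    by (elim exE bexE)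
  from add.IH(2) obtain e Q where Q: "Q \<in> param_polys e" "\<forall>x t. g (x, t) = poly (Q x) t"
    by (elim exE bexE)
  have "(\<lambda>x. P x + Q x) \<in> param_polys (max d e)"
    using P(1) Q(1) by (auto simp: param_polys_def)
  then show ?case using P Q by (intro exI[of _ "max d e"] bexI[of _ "\<lambda>x. P x + Q x"]) auto
next
  case (mult f g)
  from mult.IH(1) obtain d P where P: "P \<in> param_polys d" "\<forall>x t. f (x, t) = poly (P x) t"
    by (elim exE bexE)
  from mult.IH(2) obtain e Q where Q: "Q \<in> param_polys e" "\<forall>x t. g (x, t) = poly (Q x) t"
    by (elim exE bexE)
  have "coeff (P x * Q x) i = 0" if "i \<ge> d + e" for x i
    unfolding coeff_mult
  proof (rule sum.neutral, rule ballI)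
    fix k assume "k \<in> {..i}"
    then have "k \<ge> d \<or> i - k \<ge> e" using that by auto
    then show "coeff (P x) k * coeff (Q x) (i - k) = 0"
      using P(1) Q(1) by (auto simp: param_polys_def)
  qed
  moreover have "real_polynomial_function (\<lambda>x. coeff (P x * Q x) i)" for i
    unfolding coeff_mult
    using P(1) Q(1) by (intro real_polynomial_function_sum real_polynomial_function.intros(4))
      (auto simp: param_polys_def)
  ultimately have "(\<lambda>x. P x * Q x) \<in> param_polys (d + e)"
    by (auto simp: param_polys_def)
  then show ?case using P Q by (intro exI[of _ "d + e"] bexI[of _ "\<lambda>x. P x * Q x"]) auto
qed

section \<open>Predicates determined by finitely many polynomial signs\<close>

text \<open>
  This is a form of semialgebraicity that makes closure under Boolean operations immediate and
  matches the back-and-forth statement of elimination. Since \<^const>\<open>same_signs\<close> is symmetric, the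
  implication from \<open>P x\<close> to \<open>P y\<close> amounts to an equivalence.
\<close>

definition definable :: "('a::real_normed_vector \<Rightarrow> bool) \<Rightarrow> bool" where
  "definable P \<longleftrightarrow> (\<exists>G. finite G \<and> (\<forall>g\<in>G. real_polynomial_function g) \<and>
     (\<forall>x y. same_signs G x y \<longrightarrow> P x \<longrightarrow> P y))"

lemma definableI:
  assumes "finite G" "\<And>g. g \<in> G \<Longrightarrow> real_polynomial_function g"
    and "\<And>x y. same_signs G x y \<Longrightarrow> P x \<Longrightarrow> P y"
  shows "definable P"
proof -
  have "\<forall>x y. same_signs G x y \<longrightarrow> P x \<longrightarrow> P y"
    by (intro allI impI) (rule assms(3))
  moreover have "\<forall>g\<in>G. real_polynomial_function g" by (intro ballI assms(2))
  ultimately show ?thesis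
    unfolding definable_def using assms(1) by (intro exI[of _ G] conjI)
qed

lemma definableE:
  assumes "definable P"
  obtains G where "finite G" "\<And>g. g \<in> G \<Longrightarrow> real_polynomial_function g"
    and "\<And>x y. same_signs G x y \<Longrightarrow> P x \<Longrightarrow> P y"
proof -
  from assms obtain G where G: "finite G \<and> (\<forall>g\<in>G. real_polynomial_function g) \<and>
    (\<forall>x y. same_signs G x y \<longrightarrow> P x \<longrightarrow> P y)" unfolding definable_def ..
  show thesis
  proof (rule that)
    show "finite G" using G by (rule conjunct1)
    show "real_polynomial_function g" if "g \<in> G" for g using G that by blast
    show "P y" if "same_signs G x y" "P x" for x y using conjunct2[OF conjunct2[OF G]] that by iprover
  qed
qed

lemma definable_Ex_real:
  fixes P :: "'a::real_normed_vector \<times> real \<Rightarrow> bool"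
  assumes "definable P"
  shows "definable (\<lambda>x. \<exists>t. P (x, t))"
proof (rule definableE[OF assms])
  fix G assume G: "finite G" "\<And>g. g \<in> G \<Longrightarrow> real_polynomial_function g"
    "\<And>x y. same_signs G x y \<Longrightarrow> P x \<Longrightarrow> P y"
  have "\<forall>g\<in>G. \<exists>d. \<exists>p\<in>param_polys d. \<forall>x t. g (x, t) = poly (p x) t"
    using G(2) real_polynomial_function_as_param_poly by blast
  then obtain d p where dp: "\<And>g. g \<in> G \<Longrightarrow> p g \<in> param_polys (d g)"
    "\<And>g x t. g \<in> G \<Longrightarrow> g (x, t) = poly (p g x) t" by metis
  define m where "m = Max (insert 0 (d ` G))"
  have "d g \<le> m" if "g \<in> G" for g using G(1) that by (auto simp: m_def intro!: Max_ge simp del: Max_insert)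
  then have "p ` G \<subseteq> param_polys m"
    using dp(1) param_polys_mono by blast
  then have "eliminable (p ` G)" using eliminable_param_polys[of "p ` G" m] G(1) by blast
  then obtain H where H0: "finite H \<and> (\<forall>h\<in>H. real_polynomial_function h) \<and>
    (\<forall>x y. same_signs H x y \<longrightarrow> (\<forall>t. \<exists>s. \<forall>q\<in>p ` G. sgn (poly (q x) t) = sgn (poly (q y) s)))"
    unfolding eliminable_def ..
  note H = conjunct1[OF H0] conjunct1[OF conjunct2[OF H0]] conjunct2[OF conjunct2[OF H0]]
  have H3: "\<exists>s. P (y, s)" if xy: "same_signs H x y" and "P (x, t)" for x y t
  proof -
    obtain s where "\<forall>q\<in>p ` G. sgn (poly (q x) t) = sgn (poly (q y) s)" using H(3) xy by blast
    then have "same_signs G (x, t) (y, s)" by (auto simp: same_signs_def dp(2))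
    then show ?thesis using G(3) that(2) by blast
  qed
  show ?thesis
  proof (rule definableI[of H])
    show "\<exists>t. P (y, t)" if "same_signs H x y" "\<exists>t. P (x, t)" for x y
      using that H3 by blast
  qed (use H(1,2) in auto)
qed

lemma definable_pos:
  assumes "real_polynomial_function p"
  shows "definable (\<lambda>x. 0 < p x)"
proof (rule definableI[of "{p}"])
  show "0 < p y" if "same_signs {p} x y" "0 < p x" for x y
    using that by (simp add: same_signs_def flip: sgn_1_pos)
qed (use assms in auto)

lemma definable_Not:
  assumes "definable P"
  shows "definable (\<lambda>x. \<not> P x)"
proof (rule definableE[OF assms])
  fix G assume G: "finite G" "\<And>g. g \<in> G \<Longrightarrow> real_polynomial_function g"
    "\<And>x y. same_signs G x y \<Longrightarrow> P x \<Longrightarrow> P y"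
  show ?thesis
  proof (rule definableI[of G])
    show "\<not> P y" if "same_signs G x y" "\<not> P x" for x y
      using G(3)[OF same_signs_sym[OF that(1)]] that(2) by argo
  qed (use G(1,2) in auto)
qed

lemma definable_conj:
  assumes "definable P" "definable Q"
  shows "definable (\<lambda>x. P x \<and> Q x)"
proof (rule definableE[OF assms(1)], rule definableE[OF assms(2)])
  fix G H assume GH: "finite G" "\<And>g. g \<in> G \<Longrightarrow> real_polynomial_function g"
      "finite H" "\<And>g. g \<in> H \<Longrightarrow> real_polynomial_function g"
    and GP: "\<And>x y. same_signs G x y \<Longrightarrow> P x \<Longrightarrow> P y"
    and HQ: "\<And>x y. same_signs H x y \<Longrightarrow> Q x \<Longrightarrow> Q y"
  show ?thesis
  proof (rule definableI[of "G \<union> H"])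
    show "P y \<and> Q y" if "same_signs (G \<union> H) x y" "P x \<and> Q x" for x y
      using that GP[of x y] HQ[of x y] by (simp add: same_signs_Un)
  qed (use GH in auto)
qed

lemma definable_disj:
  assumes "definable P" "definable Q"
  shows "definable (\<lambda>x. P x \<or> Q x)"
proof -
  have "definable (\<lambda>x. \<not> (\<not> P x \<and> \<not> Q x))"
    by (intro definable_Not definable_conj assms)
  then show ?thesis by (simp only: de_Morgan_conj not_not)
qed

lemma definable_preimage:
  assumes "definable P" "polynomial_function h"
  shows "definable (\<lambda>x. P (h x))"
proof (rule definableE[OF assms(1)])
  fix G assume G: "finite G" "\<And>g. g \<in> G \<Longrightarrow> real_polynomial_function g"
    "\<And>x y. same_signs G x y \<Longrightarrow> P x \<Longrightarrow> P y"
  show ?thesis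
  proof (rule definableI[of "(\<lambda>g. g \<circ> h) ` G"])
    show "P (h y)" if "same_signs ((\<lambda>g. g \<circ> h) ` G) x y" "P (h x)" for x y
      using that(1) by (intro G(3)[OF _ that(2)]) (simp add: same_signs_def)
  qed (use G(1,2) assms(2) in auto)
qed


text \<open>
  A vector is quantified one basis direction at a time: the auxiliary predicate asserts the existence
  of a suitable displacement of the second component in the span of a finite set of directions, and it can be
  evaluated at displacement zero once the directions span the space.
\<close>

lemma definable_Ex_euclidean:
  fixes P :: "'a::real_normed_vector \<times> 'b::euclidean_space \<Rightarrow> bool"
  assumes "definable P"
  shows "definable (\<lambda>x. \<exists>y. P (x, y))"
proof -
  have span: "definable (\<lambda>z. \<exists>v\<in>span S. P (fst z, snd z + v))" if "finite S" for S :: "'b set"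
    using that
  proof (induction S rule: finite_induct)
    case empty
    show ?case using assms by simp
  next
    case (insert b S)
    have "bounded_linear (\<lambda>w::('a \<times> 'b) \<times> real. (fst (fst w), snd (fst w) + snd w *\<^sub>R b))"
      by (intro bounded_linear_Pair bounded_linear_add bounded_linear_fst_comp bounded_linear_snd_comp
          bounded_linear_fst bounded_linear_snd bounded_linear_scaleR_const)
    then have "polynomial_function (\<lambda>w::('a \<times> 'b) \<times> real. (fst (fst w), snd (fst w) + snd w *\<^sub>R b))"
      by (rule polynomial_function_bounded_linear)
    from definable_Ex_real[OF definable_preimage[OF insert.IH this]]
    have "definable (\<lambda>z. \<exists>t. \<exists>v\<in>span S. P (fst z, snd z + t *\<^sub>R b + v))" by simp
    moreover have "(\<exists>v\<in>span (insert b S). P (fst z, snd z + v)) \<longleftrightarrow>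
        (\<exists>t. \<exists>v\<in>span S. P (fst z, snd z + t *\<^sub>R b + v))" for z
    proof
      assume "\<exists>v\<in>span (insert b S). P (fst z, snd z + v)"
      then obtain v k where "v - k *\<^sub>R b \<in> span S" "P (fst z, snd z + v)"
        by (auto simp: span_breakdown_eq)
      then show "\<exists>t. \<exists>v\<in>span S. P (fst z, snd z + t *\<^sub>R b + v)"
        by (intro exI[of _ k] bexI[of _ "v - k *\<^sub>R b"]) auto
    next
      assume "\<exists>t. \<exists>v\<in>span S. P (fst z, snd z + t *\<^sub>R b + v)"
      then obtain t v where "v \<in> span S" "P (fst z, snd z + t *\<^sub>R b + v)" by blast
      then show "\<exists>v\<in>span (insert b S). P (fst z, snd z + v)"
        by (intro bexI[of _ "t *\<^sub>R b + v"]) (auto simp: span_breakdown_eq add.assoc intro: exI[of _ t])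
    qed
    ultimately show ?case by presburger
  qed
  have "polynomial_function (\<lambda>x::'a. (x, 0::'b))"
    by (intro polynomial_function_bounded_linear bounded_linear_Pair bounded_linear_ident bounded_linear_zero)
  from definable_preimage[OF span[OF finite_Basis] this] show ?thesis by simp
qed

lemma definable_False: "definable (\<lambda>_. False)"
  by (rule definableI[of "{}"]) auto

lemma semialgebraic_imp_definable:
  assumes "semialgebraic A"
  shows "definable (\<lambda>x. x \<in> A)"
proof -
  obtain \<B> where B: "finite \<B>" "\<And>B. B \<in> \<B> \<Longrightarrow> basic_semialgebraic B" "A = \<Union>\<B>"
    using assms unfolding semialgebraic_def by auto
  have basic: "definable (\<lambda>x. x \<in> B)" if "basic_semialgebraic B" for B :: "'a set"
  proof -
    from that obtain G where "\<exists>H. finite G \<and> finite H \<and> (\<forall>g\<in>G. real_polynomial_function g) \<and>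
        (\<forall>h\<in>H. real_polynomial_function h) \<and> B = {x. (\<forall>g\<in>G. g x = 0) \<and> (\<forall>h\<in>H. h x > 0)}"
      unfolding basic_semialgebraic_def ..
    then obtain H where *: "finite G \<and> finite H \<and> (\<forall>g\<in>G. real_polynomial_function g) \<and>
        (\<forall>h\<in>H. real_polynomial_function h) \<and> B = {x. (\<forall>g\<in>G. g x = 0) \<and> (\<forall>h\<in>H. h x > 0)}" ..
    then have Beq: "B = {x. (\<forall>g\<in>G. g x = 0) \<and> (\<forall>h\<in>H. h x > 0)}" by iprover
    have GH: "finite (G \<union> H)" "\<And>g. g \<in> G \<union> H \<Longrightarrow> real_polynomial_function g"
      using * by blast+
    show ?thesis
    proof (rule definableI[of "G \<union> H"])
      show "y \<in> B" if xy: "same_signs (G \<union> H) x y" and x: "x \<in> B" for x y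
      proof -
        have "g y = 0" if "g \<in> G" for g
        proof -
          have "g x = 0" using x Beq that by blast
          then have "sgn (g y) = 0" using same_signsD[OF xy, of g] that by simp
          then show ?thesis by (simp add: sgn_0_0)
        qed
        moreover have "h y > 0" if "h \<in> H" for h
        proof -
          have "h x > 0" using x Beq that by blast
          then have "sgn (h y) = 1" using same_signsD[OF xy, of h] that by simp
          then show ?thesis by (simp add: sgn_1_pos)
        qed
        ultimately show ?thesis using Beq by simp
      qed
    qed (use GH in auto)
  qed
  have "definable (\<lambda>x. x \<in> \<Union>\<C>)" if "finite \<C>" "\<C> \<subseteq> \<B>" for \<C>
    using that
  proof (induction \<C> rule: finite_induct)
    case empty
    then show ?case using definable_False by simp
  next
    case (insert C \<C>)
    have "definable (\<lambda>x. x \<in> \<Union>\<C>)" "definable (\<lambda>x. x \<in> C)"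
      using insert basic[OF B(2)[of C]] by blast+
    then have "definable (\<lambda>x. x \<in> C \<or> x \<in> \<Union>\<C>)"
      by (rule definable_disj[rotated])
    then show ?case by (simp only: Union_insert Un_iff)
  qed
  then show ?thesis using B by blast
qed

section \<open>Signs of polynomials on a thin horn at the origin\<close>

lemma real_polynomial_function_real_imp_poly:
  fixes a :: "real \<Rightarrow> real"
  assumes "real_polynomial_function a"
  obtains r :: "real poly" where "\<And>s. a s = poly r s"
proof -
  obtain b n where "a = (\<lambda>s. \<Sum>i\<le>n. b i * s ^ i)"
    using real_polynomial_function_imp_sum[OF assms] by blast
  then show thesis
    by (intro that[of "\<Sum>i\<le>n. monom (b i) i"]) (simp add: poly_sum poly_monom)
qed

lemma poly_sign_and_growth_near_0:
  fixes r :: "real poly"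
  assumes "r \<noteq> 0"
  shows "\<exists>k c e. c \<noteq> 0 \<and> e > 0 \<and>
    (\<forall>s. 0 < s \<and> s < e \<longrightarrow> sgn (poly r s) = sgn c \<and> \<bar>c\<bar> * s ^ k \<le> \<bar>poly r s\<bar>)"
  using assms
proof (induction r)
  case (pCons a r)
  show ?case
  proof (cases "a = 0")
    case True
    then have "r \<noteq> 0" using pCons by auto
    then obtain k c e where *: "c \<noteq> 0" "e > 0"
      "\<And>s. 0 < s \<Longrightarrow> s < e \<Longrightarrow> sgn (poly r s) = sgn c \<and> \<bar>c\<bar> * s ^ k \<le> \<bar>poly r s\<bar>"
      using pCons.IH by blast
    have "sgn (poly (pCons a r) s) = sgn c \<and> \<bar>c\<bar> * s ^ Suc k \<le> \<bar>poly (pCons a r) s\<bar>"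
      if "0 < s" "s < e" for s
      using *(3)[OF that] that True mult_left_mono[of "\<bar>c\<bar> * s ^ k" "\<bar>poly r s\<bar>" s]
      by (simp add: sgn_mult abs_mult mult_ac)
    then show ?thesis using *(1,2) by blast
  next
    case False
    let ?p = "poly (pCons a r)"
    have "isCont ?p 0" by (rule poly_isCont)
    then have "(?p \<longlongrightarrow> ?p 0) (at 0)" unfolding isCont_def .
    then have "(?p \<longlongrightarrow> a) (at 0)" by (metis poly_pCons add.right_neutral mult_zero_left)
    then have "\<forall>\<^sub>F s in at 0. dist (?p s) a < \<bar>a\<bar> / 2"
      by (rule tendstoD) (use False in simp)
    then obtain e where e: "e > 0" "\<And>s. s \<noteq> 0 \<Longrightarrow> dist s 0 < e \<Longrightarrow> dist (?p s) a < \<bar>a\<bar> / 2"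
      unfolding eventually_at by auto
    have "sgn (?p s) = sgn (a / 2) \<and> \<bar>a / 2\<bar> * s ^ 0 \<le> \<bar>?p s\<bar>" if "0 < s" "s < e" for s
    proof -
      have "\<bar>?p s - a\<bar> < \<bar>a\<bar> / 2" using e(2)[of s] that by (simp add: dist_real_def)
      then show ?thesis using False by (cases "a > 0") (auto simp: sgn_if abs_if split: if_splits)
    qed
    then show ?thesis using False e(1) by (intro exI[of _ "0::nat"] exI[of _ "a / 2"] exI[of _ e]) simp
  qed
qed simp

lemma param_poly_pCons_decomposition:
  assumes "P \<in> param_polys (Suc d)"
  shows "(\<lambda>x. poly_shift 1 (P x)) \<in> param_polys d"
    and "poly (P x) t = coeff (P x) 0 + t * poly (poly_shift 1 (P x)) t"
proof -
  show "(\<lambda>x. poly_shift 1 (P x)) \<in> param_polys d"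
    using assms by (auto simp: param_polys_def coeff_poly_shift)
  have "P x = pCons (coeff (P x) 0) (poly_shift 1 (P x))"
    by (auto simp: poly_eq_iff coeff_pCons coeff_poly_shift split: nat.splits)
  then show "poly (P x) t = coeff (P x) 0 + t * poly (poly_shift 1 (P x)) t"
    by (metis poly_pCons)
qed

lemma param_poly_bounded:
  fixes P :: "real \<Rightarrow> real poly"
  assumes "P \<in> param_polys d"
  shows "\<exists>M>0. \<forall>s t. 0 \<le> s \<and> s \<le> 1 \<and> 0 \<le> t \<and> t \<le> 1 \<longrightarrow> \<bar>poly (P s) t\<bar> \<le> M"
  using assms
proof (induction d arbitrary: P)
  case 0
  then have "P = (\<lambda>x. 0)" by (rule param_polys_0)
  then show ?case by (intro exI[of _ 1]) auto
next
  case (Suc d)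
  obtain M where M: "M > 0" "\<And>s t. 0 \<le> s \<Longrightarrow> s \<le> 1 \<Longrightarrow> 0 \<le> t \<Longrightarrow> t \<le> 1 \<Longrightarrow> \<bar>poly (poly_shift 1 (P s)) t\<bar> \<le> M"
    using Suc.IH[OF param_poly_pCons_decomposition(1)[OF Suc.prems]] by blast
  have "real_polynomial_function (\<lambda>s. coeff (P s) 0)" using Suc.prems by (simp add: param_polys_def)
  then have "continuous_on {0..1} (\<lambda>s. coeff (P s) 0)"
    by (intro continuous_on_polymonial_function) (simp flip: real_polynomial_function_eq)
  then have "bounded ((\<lambda>s. coeff (P s) 0) ` {0..1})"
    by (intro compact_imp_bounded compact_continuous_image) auto
  then obtain K where K: "K > 0" "\<And>s. 0 \<le> s \<Longrightarrow> s \<le> 1 \<Longrightarrow> \<bar>coeff (P s) 0\<bar> \<le> K"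
    unfolding bounded_pos by auto
  have "\<bar>poly (P s) t\<bar> \<le> K + M" if "0 \<le> s" "s \<le> 1" "0 \<le> t" "t \<le> 1" for s t
  proof -
    have "\<bar>t * poly (poly_shift 1 (P s)) t\<bar> \<le> 1 * M"
      unfolding abs_mult using M(2)[OF that] that by (intro mult_mono) auto
    then show ?thesis
      unfolding param_poly_pCons_decomposition(2)[OF Suc.prems, of s t] using K(2)[of s] that by linarith
  qed
  then show ?case using K(1) M(1) by (intro exI[of _ "K + M"]) auto
qed

text \<open>
  Induction on the degree in \<open>t\<close>, splitting off the constant coefficient \<open>r\<close>. If \<open>r = 0\<close>, the factor \<open>t > 0\<close>
  does not affect the sign. Otherwise \<open>r s\<close> is at least of order \<open>s ^ k\<close>, whereas
  the rest is at most a constant multiple of \<open>t < s ^ (k + 1)\<close>.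
\<close>

lemma param_poly_sign_on_horn:
  fixes P :: "real \<Rightarrow> real poly"
  assumes "P \<in> param_polys d"
  shows "\<exists>\<sigma> N e. e > 0 \<and> (\<forall>s t. 0 < s \<and> s < e \<and> 0 < t \<and> t < s ^ N \<longrightarrow> sgn (poly (P s) t) = \<sigma>)"
  using assms
proof (induction d arbitrary: P)
  case 0
  then have "P = (\<lambda>x. 0)" by (rule param_polys_0)
  then show ?case by (intro exI[of _ 0] exI[of _ 1]) auto
next
  case (Suc d)
  let ?Q = "\<lambda>x. poly_shift 1 (P x)"
  note Q = param_poly_pCons_decomposition(1)[OF Suc.prems]
  note dec = param_poly_pCons_decomposition(2)[OF Suc.prems]
  have "real_polynomial_function (\<lambda>s. coeff (P s) 0)" using Suc.prems by (simp add: param_polys_def)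
  then obtain r where r: "\<And>s. coeff (P s) 0 = poly r s"
    using real_polynomial_function_real_imp_poly by blast
  show ?case
  proof (cases "r = 0")
    case True
    obtain \<sigma> N e where *: "e > 0" "\<And>s t. 0 < s \<Longrightarrow> s < e \<Longrightarrow> 0 < t \<Longrightarrow> t < s ^ N \<Longrightarrow> sgn (poly (?Q s) t) = \<sigma>"
      using Suc.IH[OF Q] by blast
    have "sgn (poly (P s) t) = \<sigma>" if "0 < s" "s < e" "0 < t" "t < s ^ N" for s t
    proof -
      have "poly (P s) t = t * poly (?Q s) t" unfolding dec[of s t] r True by simp
      then show ?thesis using *(2)[OF that] that(3) by (simp add: sgn_mult)
    qed
    then show ?thesis using *(1) by blast
  next
    case False
    obtain k c e where ce: "c \<noteq> 0" "e > 0"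
      "\<And>s. 0 < s \<Longrightarrow> s < e \<Longrightarrow> sgn (poly r s) = sgn c \<and> \<bar>c\<bar> * s ^ k \<le> \<bar>poly r s\<bar>"
      using poly_sign_and_growth_near_0[OF False] by blast
    obtain M where M: "M > 0" "\<And>s t. 0 \<le> s \<Longrightarrow> s \<le> 1 \<Longrightarrow> 0 \<le> t \<Longrightarrow> t \<le> 1 \<Longrightarrow> \<bar>poly (?Q s) t\<bar> \<le> M"
      using param_poly_bounded[OF Q] by blast
    define e' where "e' = min e (min 1 (\<bar>c\<bar> / M))"
    have "sgn (poly (P s) t) = sgn c" if st: "0 < s" "s < e'" "0 < t" "t < s ^ Suc k" for s t
    proof -
      have s: "s < e" "s < 1" "s * M < \<bar>c\<bar>" using st M(1) by (auto simp: e'_def field_simps)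
      have "t \<le> 1" using st s power_le_one[of s "Suc k"] by simp
      then have "\<bar>t * poly (?Q s) t\<bar> \<le> t * M"
        unfolding abs_mult using M(2)[of s t] st s by (intro mult_mono) auto
      also have "\<dots> < s ^ Suc k * M" using st M(1) by simp
      also have "\<dots> = (s * M) * s ^ k" by simp
      also have "\<dots> < \<bar>c\<bar> * s ^ k" using s st by (intro mult_strict_right_mono) auto
      also have "\<dots> \<le> \<bar>poly r s\<bar>" using ce(3) st s by blast
      finally have "\<bar>t * poly (?Q s) t\<bar> < \<bar>poly r s\<bar>" .
      then have "sgn (poly (P s) t) = sgn (poly r s)"
        unfolding dec r by (auto simp: sgn_if abs_if split: if_splits)
      then show ?thesis using ce(3) st s by simp
    qed
    moreover have "e' > 0" using ce M by (simp add: e'_def)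
    ultimately show ?thesis by blast
  qed
qed

text \<open>
  The horns form a basis of a filter on the plane that decides every definable predicate. This is what replaces
  the study of semialgebraic functions of one variable.
\<close>

lemma definable_constant_on_horn:
  fixes P :: "real \<times> real \<Rightarrow> bool"
  assumes "definable P"
  shows "\<exists>N e. e > 0 \<and> (\<forall>s t s' t'. 0 < s \<and> s < e \<and> 0 < t \<and> t < s ^ N \<longrightarrow>
     0 < s' \<and> s' < e \<and> 0 < t' \<and> t' < s' ^ N \<longrightarrow> P (s, t) \<longrightarrow> P (s', t'))"
proof (rule definableE[OF assms])
  fix G assume G: "finite G" "\<And>g. g \<in> G \<Longrightarrow> real_polynomial_function g"
    "\<And>x y. same_signs G x y \<Longrightarrow> P x \<Longrightarrow> P y"
  have "\<exists>\<sigma> N e. e > 0 \<and> (\<forall>s t. 0 < s \<and> s < e \<and> 0 < t \<and> t < s ^ N \<longrightarrow> sgn (g (s, t)) = \<sigma>)"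
    if "g \<in> G" for g
  proof -
    have "real_polynomial_function g" using G(2) that .
    then obtain d p where "p \<in> param_polys d" "\<forall>s t. g (s, t) = poly (p s) t"
      using real_polynomial_function_as_param_poly by blast
    then show ?thesis using param_poly_sign_on_horn[of p d] by simp
  qed
  then obtain \<sigma> N e where H: "\<And>g. g \<in> G \<Longrightarrow> e g > 0"
    "\<And>g s t. g \<in> G \<Longrightarrow> 0 < s \<Longrightarrow> s < e g \<Longrightarrow> 0 < t \<Longrightarrow> t < s ^ N g \<Longrightarrow> sgn (g (s, t)) = \<sigma> g"
    by metis
  define e' where "e' = Min (insert 1 (e ` G))"
  define N' where "N' = Max (insert 0 (N ` G))"
  have e': "e' > 0" "e' \<le> 1" "\<And>g. g \<in> G \<Longrightarrow> e' \<le> e g"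
    using G(1) H(1) by (auto simp: e'_def simp del: Min_insert)
  have N': "N g \<le> N'" if "g \<in> G" for g
    using G(1) that by (auto simp: N'_def intro!: Max_ge simp del: Max_insert)
  have sg: "sgn (g (s, t)) = \<sigma> g" if "g \<in> G" "0 < s" "s < e'" "0 < t" "t < s ^ N'" for g s t
  proof -
    have "s ^ N' \<le> s ^ N g" using that e'(2) N'[OF that(1)] by (intro power_decreasing) auto
    then show ?thesis using H(2)[of g s t] that e'(3)[of g] by simp
  qed
  have "P (s', t')" if st: "0 < s \<and> s < e' \<and> 0 < t \<and> t < s ^ N'"
    "0 < s' \<and> s' < e' \<and> 0 < t' \<and> t' < s' ^ N'" and "P (s, t)" for s t s' t'
  proof (rule G(3))
    show "same_signs G (s, t) (s', t')" unfolding same_signs_def using sg st by simp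
  qed fact
  then show ?thesis using e'(1) by blast
qed

section \<open>The Lojasiewicz inequality on balls\<close>

lemma real_polynomial_function_inner_self:
  fixes h :: "'a::real_normed_vector \<Rightarrow> 'b::euclidean_space"
  assumes "polynomial_function h"
  shows "real_polynomial_function (\<lambda>x. h x \<bullet> h x)"
proof -
  have "real_polynomial_function (\<lambda>x. h x \<bullet> b)" for b
    unfolding real_polynomial_function_eq using assms by (rule polynomial_function_inner)
  then have "real_polynomial_function (\<lambda>x. \<Sum>b\<in>Basis. (h x \<bullet> b) * (h x \<bullet> b))"
    by (intro real_polynomial_function_sum real_polynomial_function.intros(4)) auto
  then show ?thesis by (simp only: euclidean_inner[symmetric])
qed

text \<open>
  The predicate \<open>\<Phi>\<close> is the one described at the beginning. Distances are squared in its
  definition to make it visibly polynomial, and the condition that the distance from \<open>x\<close> to \<open>S\<close> is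
  at least \<open>s\<close> becomes the absence of a closer point of \<open>S\<close>.
\<close>

lemma lojasiewicz_near_zero_set:
  fixes f :: "'a::euclidean_space \<Rightarrow> real"
  assumes cont: "continuous_on UNIV f" and sa: "semialgebraic_function f"
    and ne: "{x. f x \<le> 0} \<noteq> {}" and r: "0 \<le> r"
  defines "S \<equiv> {x. f x \<le> 0}"
  shows "\<exists>N e. e > 0 \<and> (\<forall>x. norm x \<le> r \<and> 0 < infdist x S \<and> infdist x S < e \<longrightarrow>
           infdist x S ^ N \<le> f x)"
proof -
  have le: "definable (\<lambda>z::'a \<times> real. f (fst z) \<le> snd z)"
  proof -
    have "definable (\<lambda>z. z \<in> {(x, y). y = f x})"
      using sa unfolding semialgebraic_function_def by (rule semialgebraic_imp_definable)
    moreover have "polynomial_function (\<lambda>w::('a \<times> real) \<times> real. (fst (fst w), snd w))"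
      by (intro polynomial_function_bounded_linear bounded_linear_Pair bounded_linear_fst_comp
          bounded_linear_fst bounded_linear_snd)
    ultimately have "definable (\<lambda>w::('a \<times> real) \<times> real. (fst (fst w), snd w) \<in> {(x, y). y = f x})"
      by (rule definable_preimage)
    moreover have "definable (\<lambda>w::('a \<times> real) \<times> real. \<not> 0 < snd w - snd (fst w))"
      by (intro definable_Not definable_pos real_polynomial_function.intros(1) bounded_linear_sub
          bounded_linear_snd bounded_linear_snd_comp bounded_linear_fst)
    ultimately have "definable (\<lambda>w::('a \<times> real) \<times> real.
        (fst (fst w), snd w) \<in> {(x, y). y = f x} \<and> \<not> 0 < snd w - snd (fst w))"
      by (rule definable_conj)
    from definable_Ex_real[OF this] show ?thesis by (simp add: not_less)
  qed
  define \<Phi> where "\<Phi> = (\<lambda>w::real \<times> real. \<exists>x. (\<not> 0 < x \<bullet> x - r\<^sup>2 \<and> f x \<le> snd w) \<and>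
    \<not> (\<exists>y. f y \<le> 0 \<and> 0 < fst w * fst w - (x - y) \<bullet> (x - y)))"
  have "definable \<Phi>"
  proof -
    have 1: "definable (\<lambda>u::(real \<times> real) \<times> 'a. \<not> 0 < snd u \<bullet> snd u - r\<^sup>2)"
      by (intro definable_Not definable_pos real_polynomial_function_diff real_polynomial_function_inner_self
          real_polynomial_function.intros(2) polynomial_function_bounded_linear bounded_linear_snd)
    have 2: "definable (\<lambda>u::(real \<times> real) \<times> 'a. f (snd u) \<le> snd (fst u))"
    proof -
      have "polynomial_function (\<lambda>u::(real \<times> real) \<times> 'a. (snd u, snd (fst u)))"
        by (intro polynomial_function_bounded_linear bounded_linear_Pair bounded_linear_snd_comp
            bounded_linear_fst bounded_linear_snd)
      from definable_preimage[OF le this] show ?thesis by simp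
    qed
    have 3: "definable (\<lambda>v::((real \<times> real) \<times> 'a) \<times> 'a. f (snd v) \<le> 0)"
    proof -
      have "polynomial_function (\<lambda>v::((real \<times> real) \<times> 'a) \<times> 'a. (snd v, 0::real))"
        by (intro polynomial_function_bounded_linear bounded_linear_Pair bounded_linear_zero bounded_linear_snd)
      from definable_preimage[OF le this] show ?thesis by simp
    qed
    have 4: "definable (\<lambda>v::((real \<times> real) \<times> 'a) \<times> 'a.
       0 < fst (fst (fst v)) * fst (fst (fst v)) - (snd (fst v) - snd v) \<bullet> (snd (fst v) - snd v))"
      by (intro definable_pos real_polynomial_function_diff real_polynomial_function_inner_self
          real_polynomial_function.intros(4) real_polynomial_function.intros(1)
          polynomial_function_bounded_linear bounded_linear_sub bounded_linear_fst_comp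
          bounded_linear_snd_comp bounded_linear_fst bounded_linear_snd)
    from definable_Not[OF definable_Ex_euclidean[OF definable_conj[OF 3 4]]]
    have 5: "definable (\<lambda>u::(real \<times> real) \<times> 'a.
       \<not> (\<exists>y. f y \<le> 0 \<and> 0 < fst (fst u) * fst (fst u) - (snd u - y) \<bullet> (snd u - y)))" by simp
    from definable_Ex_euclidean[OF definable_conj[OF definable_conj[OF 1 2] 5]]
    show ?thesis unfolding \<Phi>_def by simp
  qed
  have \<Phi>: "\<Phi> (s, t) \<longleftrightarrow> (\<exists>x. norm x \<le> r \<and> f x \<le> t \<and> s \<le> infdist x S)" if "0 < s" for s t
  proof -
    have "\<not> 0 < x \<bullet> x - r\<^sup>2 \<longleftrightarrow> norm x \<le> r" for x :: 'a
      using r by (simp add: norm_le_square not_less)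
    moreover have "\<not> 0 < s * s - (x - y) \<bullet> (x - y) \<longleftrightarrow> s \<le> dist x y" for x y :: 'a
      using that by (simp add: norm_ge_square not_less dist_norm power2_eq_square)
    moreover have "s \<le> infdist x S \<longleftrightarrow> (\<forall>y\<in>S. s \<le> dist x y)" for x
      using ne infdist_le[of _ S x] unfolding S_def[symmetric]
      by (auto simp: infdist_notempty intro: cINF_greatest order_trans)
    ultimately show ?thesis by (auto simp: \<Phi>_def S_def)
  qed
  obtain N e where Ne: "e > 0" "\<And>s t s' t'. 0 < s \<and> s < e \<and> 0 < t \<and> t < s ^ N \<Longrightarrow>
     0 < s' \<and> s' < e \<and> 0 < t' \<and> t' < s' ^ N \<Longrightarrow> \<Phi> (s, t) \<Longrightarrow> \<Phi> (s', t')"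
    using definable_constant_on_horn[OF \<open>definable \<Phi>\<close>] by blast
  have small: "\<exists>t0>0. \<forall>t<t0. \<not> \<Phi> (s, t)" if "0 < s" for s
  proof -
    let ?K = "cball 0 r \<inter> {x. s \<le> infdist x S}"
    show ?thesis
    proof (cases "?K = {}")
      case True
      then show ?thesis using \<Phi>[OF that] by (intro exI[of _ 1]) auto
    next
      case False
      have "closed {x. s \<le> infdist x S}"
        by (intro closed_Collect_le continuous_intros)
      then have "compact ?K" by (intro compact_Int_closed) auto
      then obtain x0 where x0: "x0 \<in> ?K" "\<And>x. x \<in> ?K \<Longrightarrow> f x0 \<le> f x"
        using continuous_attains_inf[OF _ False continuous_on_subset[OF cont subset_UNIV]] by blast
      have "x0 \<notin> S" using x0(1) that by auto
      then have "0 < f x0" by (simp add: S_def)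
      moreover have "\<not> \<Phi> (s, t)" if "t < f x0" for t
        using \<Phi>[OF \<open>0 < s\<close>] x0(2) that by fastforce
      ultimately show ?thesis by blast
    qed
  qed
  have none: "\<not> \<Phi> (s, t)" if "0 < s \<and> s < e \<and> 0 < t \<and> t < s ^ N" for s t
  proof
    assume \<Phi>st: "\<Phi> (s, t)"
    have "\<exists>t0>0. \<forall>t<t0. \<not> \<Phi> (s, t)" using that by (intro small) simp
    then obtain t0 where t0: "t0 > 0" "\<forall>t<t0. \<not> \<Phi> (s, t)" by blast
    define t' where "t' = min (t0 / 2) t"
    have t': "0 < t'" "t' < t0" "t' \<le> t" using that t0(1) by (auto simp: t'_def)
    then have "0 < s \<and> s < e \<and> 0 < t' \<and> t' < s ^ N" using that by linarith
    from Ne(2)[OF that this \<Phi>st] show False using t0(2) t'(2) by simp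
  qed
  have "infdist x S ^ N \<le> f x" if x: "norm x \<le> r \<and> 0 < infdist x S \<and> infdist x S < e" for x
  proof (rule ccontr)
    assume not_le: "\<not> infdist x S ^ N \<le> f x"
    have "x \<notin> S" using x by auto
    then have "0 < f x" by (simp add: S_def)
    then have "\<not> \<Phi> (infdist x S, f x)" using not_le x by (intro none) simp
    moreover have "\<Phi> (infdist x S, f x)"
      using x by (subst \<Phi>) (auto intro: exI[of _ x])
    ultimately show False by blast
  qed
  then show ?thesis using Ne(1) by blast
qed

text \<open>
  Close to \<open>S\<close> the Lojasiewicz inequality gives the power term with exponent \<open>1 / (N + 1)\<close>, which is
  positive even for \<open>N = 0\<close>. Away from \<open>S\<close>, \<open>f\<close> is bounded below by some \<open>\<delta> > 0\<close> and the distance to \<open>S\<close> is bounded,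
  so the linear term is enough.
\<close>

lemma error_bound_on_ball:
  fixes f :: "'a::euclidean_space \<Rightarrow> real"
  assumes cont: "continuous_on UNIV f" and sa: "semialgebraic_function f"
    and ne: "{x. f x \<le> 0} \<noteq> {}" and r: "0 \<le> r"
  defines "S \<equiv> {x. f x \<le> 0}"
  shows "\<exists>C \<alpha>. C > 0 \<and> \<alpha> > 0 \<and> (\<forall>x. norm x \<le> r \<longrightarrow>
           infdist x S \<le> C * (max (f x) 0 powr \<alpha> + max (f x) 0))"
proof -
  obtain N e where Ne: "e > 0" "\<And>x. norm x \<le> r \<Longrightarrow> 0 < infdist x S \<Longrightarrow> infdist x S < e \<Longrightarrow> infdist x S ^ N \<le> f x"
    using lojasiewicz_near_zero_set[OF cont sa ne r] unfolding S_def by blast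
  define e' where "e' = min e 1"
  have e': "e' > 0" using Ne(1) by (simp add: e'_def)
  let ?K = "cball 0 r \<inter> {x. e' \<le> infdist x S}"
  obtain \<delta> where d: "\<delta> > 0" "\<And>x. x \<in> ?K \<Longrightarrow> \<delta> \<le> f x"
  proof (cases "?K = {}")
    case True
    then show thesis using that[of 1] by auto
  next
    case False
    have "closed {x. e' \<le> infdist x S}"
      by (intro closed_Collect_le continuous_intros)
    then have "compact ?K" by (intro compact_Int_closed) auto
    then obtain x0 where x0: "x0 \<in> ?K" "\<And>x. x \<in> ?K \<Longrightarrow> f x0 \<le> f x"
      using continuous_attains_inf[OF _ False continuous_on_subset[OF cont subset_UNIV]] by blast
    have "x0 \<notin> S" using x0(1) e' by auto
    then have "0 < f x0" by (simp add: S_def)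
    then show thesis using that x0(2) by blast
  qed
  define D where "D = infdist 0 S + r"
  have D0: "0 \<le> D" using r infdist_nonneg[of 0 S] by (simp add: D_def)
  define \<alpha> where "\<alpha> = 1 / real (Suc N)"
  have main: "infdist x S \<le> (1 + D / \<delta>) * (max (f x) 0 powr \<alpha> + max (f x) 0)" if x: "norm x \<le> r" for x
  proof -
    have D\<delta>: "0 \<le> D / \<delta>" using D0 d(1) by simp
    have expand: "(1 + D / \<delta>) * (a + b) \<ge> a" "(1 + D / \<delta>) * (a + b) \<ge> D / \<delta> * b" if "0 \<le> a" "0 \<le> b" for a b
    proof -
      have "(1 + q) * (a + b) = a + q * b + (b + q * a)" for q by (simp add: algebra_simps)
      then have "(1 + D / \<delta>) * (a + b) = a + D / \<delta> * b + (b + D / \<delta> * a)" .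
      moreover have "0 \<le> D / \<delta> * b" "0 \<le> D / \<delta> * a"
        using mult_nonneg_nonneg[OF D\<delta>] that by blast+
      ultimately show "(1 + D / \<delta>) * (a + b) \<ge> a" "(1 + D / \<delta>) * (a + b) \<ge> D / \<delta> * b" using that by linarith+
    qed
    consider "infdist x S = 0" | "0 < infdist x S" "infdist x S < e'" | "e' \<le> infdist x S"
      using infdist_nonneg[of x S] by linarith
    then show ?thesis
    proof cases
      case 1
      then show ?thesis using D\<delta> by simp
    next
      case 2
      let ?s = "infdist x S"
      have "?s ^ Suc N \<le> ?s ^ N" using 2 by (intro power_decreasing) (auto simp: e'_def)
      also have "\<dots> \<le> f x" using Ne(2)[OF x] 2 by (simp add: e'_def)
      finally have le: "?s ^ Suc N \<le> f x" .
      then have "(?s ^ Suc N) powr \<alpha> \<le> f x powr \<alpha>" using 2 by (intro powr_mono2) (auto simp: \<alpha>_def)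
      moreover have "(?s ^ Suc N) powr \<alpha> = ?s"
        using 2 by (simp only: powr_realpow[symmetric] powr_powr \<alpha>_def) simp
      moreover have "0 < f x" using le zero_less_power[OF 2(1), of "Suc N"] by linarith
      ultimately have "?s \<le> max (f x) 0 powr \<alpha>" by simp
      then show ?thesis using expand(1)[of "max (f x) 0 powr \<alpha>" "max (f x) 0"] by simp
    next
      case 3
      then have "\<delta> \<le> f x" using d(2) x by simp
      have "infdist x S \<le> D" using infdist_triangle[of x S 0] x by (simp add: D_def)
      also have "D = D / \<delta> * \<delta>" using d(1) by simp
      also have "\<dots> \<le> D / \<delta> * max (f x) 0"
        using \<open>\<delta> \<le> f x\<close> D\<delta> by (intro mult_left_mono) auto
      finally show ?thesis using expand(2)[of "max (f x) 0 powr \<alpha>" "max (f x) 0"] by simp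
    qed
  qed
  show ?thesis
    by (intro exI[of _ "1 + D / \<delta>"] exI[of _ \<alpha>] conjI allI impI main)
       (use D0 d(1) in \<open>auto simp: \<alpha>_def intro: add_pos_nonneg\<close>)
qed

section \<open>Descent under a lower bound on the slope\<close>

text \<open>
  If \<open>f + \<phi>\<close> has a local minimum at \<open>y\<close>, then \<open>- \<phi>\<close> supports \<open>f\<close> from below at \<open>y\<close> up to a constant,
  and the first-order expansion of \<open>\<phi>\<close> bounds the difference quotient of \<open>f\<close>.
\<close>

lemma frechet_subgradient_of_smooth_minorant:
  fixes f :: "'a::euclidean_space \<Rightarrow> real"
  assumes der: "(\<phi> has_derivative (\<lambda>h. w \<bullet> h)) (at y)"
    and min: "\<forall>\<^sub>F z in nhds y. f y + \<phi> y \<le> f z + \<phi> z"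
  shows "- w \<in> frechet_subdifferential f y"
proof -
  let ?q = "\<lambda>h. (f (y + h) - f y - (- w) \<bullet> h) / norm h"
  let ?r = "\<lambda>h. norm (\<phi> (y + h) - \<phi> y - w \<bullet> h) / norm h"
  have lim: "(?r \<longlongrightarrow> 0) (at 0)" using der by (simp add: has_derivative_at)
  have ev: "\<forall>\<^sub>F h in at 0. - ?r h \<le> ?q h"
  proof -
    have "filterlim (\<lambda>h. y + h) (nhds y) (at 0)"
      by (auto intro!: tendsto_eq_intros)
    then have "\<forall>\<^sub>F h in at 0. f y + \<phi> y \<le> f (y + h) + \<phi> (y + h)"
      using min by (rule eventually_compose_filterlim[rotated])
    then show ?thesis
    proof (rule eventually_mono)
      fix h assume "f y + \<phi> y \<le> f (y + h) + \<phi> (y + h)"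
      then have "- norm (\<phi> (y + h) - \<phi> y - w \<bullet> h) \<le> f (y + h) - f y - (- w) \<bullet> h"
        unfolding real_norm_def inner_minus_left by linarith
      then show "- ?r h \<le> ?q h"
        unfolding minus_divide_left by (rule divide_right_mono) simp
    qed
  qed
  have "0 \<le> Liminf (at 0) (\<lambda>h. ereal (?q h))"
    unfolding le_Liminf_iff
  proof (intro allI impI)
    fix a :: ereal assume "a < 0"
    then obtain b :: real where b: "a \<le> ereal (- b)" "b > 0"
    proof (cases a)
      case (real x)
      then show thesis using that[of "-x"] \<open>a < 0\<close> by simp
    next
      case MInf
      then show thesis using that[of 1] by simp
    qed auto
    have "\<forall>\<^sub>F h in at 0. ?r h < b" using order_tendstoD(2)[OF lim b(2)] .
    with ev show "\<forall>\<^sub>F h in at 0. a < ereal (?q h)"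
    proof eventually_elim
      case (elim h)
      then have "ereal (- b) < ereal (?q h)" by simp
      then show ?case using b(1) by (rule le_less_trans[rotated])
    qed
  qed
  then show ?thesis by (simp add: frechet_subdifferential_def)
qed

lemma nonsmooth_slope_le:
  assumes "v \<in> frechet_subdifferential f y"
  shows "nonsmooth_slope f y \<le> ereal (norm v)"
proof -
  have "v \<in> limiting_subdifferential f y"
    unfolding limiting_subdifferential_def
    by (intro CollectI exI[of _ "\<lambda>_. y"] exI[of _ "\<lambda>_. v"] conjI exI[of _ id])
       (use assms in \<open>auto simp: strict_mono_def o_def\<close>)
  then show ?thesis unfolding nonsmooth_slope_def by (rule INF_lower)
qed

text \<open>
  Penalisation by a smoothed distance to \<open>x\<close>. The smoothing parameter \<open>\<eta>\<close> equals \<open>f x / l\<close>, so that the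
  penalty at \<open>x\<close> is exactly \<open>f x\<close> and nowhere smaller; this yields \<open>f y \<le> f x\<close> and costs only the factor 2 in
  the distance estimate.
\<close>

lemma descent_to_zero_set_or_ball:
  fixes f :: "'a::euclidean_space \<Rightarrow> real"
  assumes cont: "continuous_on UNIV f"
    and slope: "\<And>x. f x > 0 \<Longrightarrow> R \<le> norm x \<Longrightarrow> ereal c \<le> nonsmooth_slope f x"
    and l: "0 < l" "l < c" and fx: "0 < f x"
  shows "\<exists>y. l * dist x y \<le> 2 * f x \<and> f y \<le> f x \<and> (f y \<le> 0 \<or> norm y < R)"
proof -
  define \<eta> where "\<eta> = f x / l"
  have \<eta>: "0 < \<eta>" using l fx by (simp add: \<eta>_def)
  define \<phi> where "\<phi> = (\<lambda>z. l * sqrt ((z - x) \<bullet> (z - x) + \<eta>\<^sup>2))"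
  define g where "g = (\<lambda>z. max (f z) 0 + \<phi> z)"
  have pos: "0 < (z - x) \<bullet> (z - x) + \<eta>\<^sup>2" for z
    using \<eta> by (simp add: add_nonneg_pos)
  have \<phi>x: "\<phi> x = f x" using l \<eta> fx by (simp add: \<phi>_def \<eta>_def)
  have \<phi>1: "f x \<le> \<phi> z" for z
  proof -
    have "\<eta> \<le> sqrt ((z - x) \<bullet> (z - x) + \<eta>\<^sup>2)" by (intro real_le_rsqrt) simp
    then have "l * \<eta> \<le> \<phi> z" using l unfolding \<phi>_def by (intro mult_left_mono) auto
    then show ?thesis using l by (simp add: \<eta>_def)
  qed
  have nsq: "norm (z - x) \<le> sqrt ((z - x) \<bullet> (z - x) + \<eta>\<^sup>2)" for z
    by (intro real_le_rsqrt) (simp add: dot_square_norm)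
  then have \<phi>2: "l * dist x z \<le> \<phi> z" for z
    using l unfolding \<phi>_def dist_norm norm_minus_commute[of x z] by (intro mult_left_mono) auto
  have "continuous_on (cball x (2 * f x / l)) g"
    unfolding g_def \<phi>_def
    by (intro continuous_intros continuous_on_subset[OF cont]) auto
  moreover have "0 \<le> 2 * f x / l" using l fx by (intro divide_nonneg_nonneg) auto
  then have "cball x (2 * f x / l) \<noteq> {}" by (simp only: cball_eq_empty not_less)
  ultimately obtain y where y: "y \<in> cball x (2 * f x / l)" "\<And>z. z \<in> cball x (2 * f x / l) \<Longrightarrow> g y \<le> g z"
    using continuous_attains_inf[OF compact_cball] by blast
  have gx: "g x = 2 * f x" using fx by (simp add: g_def \<phi>x)
  have "g y \<le> g x" using y(2)[of x] l fx by simp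
  have glob: "g y \<le> g z" for z
  proof (cases "z \<in> cball x (2 * f x / l)")
    case False
    then have "2 * f x \<le> l * dist x z" using l by (simp add: field_simps)
    also have "\<dots> \<le> g z" using \<phi>2[of z] by (simp add: g_def)
    finally show ?thesis using \<open>g y \<le> g x\<close> gx by simp
  qed (rule y(2))
  have "l * dist x y \<le> 2 * f x" using y(1) l by (simp add: field_simps)
  moreover have "f y \<le> f x" using \<open>g y \<le> g x\<close> gx \<phi>1[of y] by (simp add: g_def)
  moreover have "f y \<le> 0 \<or> norm y < R"
  proof (rule ccontr)
    assume "\<not> (f y \<le> 0 \<or> norm y < R)"
    then have fy: "0 < f y" "R \<le> norm y" by auto
    \<comment> \<open>the gradient of the penalty at \<open>y\<close>, of norm at most \<open>l\<close>\<close>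
    define w where "w = (l / sqrt ((y - x) \<bullet> (y - x) + \<eta>\<^sup>2)) *\<^sub>R (y - x)"
    have "(\<phi> has_derivative (\<lambda>h. l * (((y - x) \<bullet> h) / sqrt ((y - x) \<bullet> (y - x) + \<eta>\<^sup>2)))) (at y)"
      unfolding \<phi>_def using pos[of y]
      by (auto intro!: derivative_eq_intros simp: inner_commute field_simps)
    then have "(\<phi> has_derivative (\<lambda>h. w \<bullet> h)) (at y)" by (simp add: w_def)
    moreover have "\<forall>\<^sub>F z in nhds y. f y + \<phi> y \<le> f z + \<phi> z"
    proof -
      have "(f \<longlongrightarrow> f y) (nhds y)"
        using cont by (simp add: continuous_on_eq_continuous_at isCont_def tendsto_nhds_iff)
      from order_tendstoD(1)[OF this fy(1)] show ?thesis
      proof (rule eventually_mono)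
        show "f y + \<phi> y \<le> f z + \<phi> z" if "0 < f z" for z
          using glob[of z] fy(1) that by (simp add: g_def)
      qed
    qed
    ultimately have "- w \<in> frechet_subdifferential f y"
      by (rule frechet_subgradient_of_smooth_minorant)
    then have "nonsmooth_slope f y \<le> ereal (norm w)" using nonsmooth_slope_le[of "- w"] by simp
    moreover have "norm w \<le> l"
    proof -
      let ?s = "sqrt ((y - x) \<bullet> (y - x) + \<eta>\<^sup>2)"
      have "norm w = l * norm (y - x) / ?s" using l pos[of y] by (simp add: w_def)
      also have "\<dots> \<le> l * ?s / ?s"
        using nsq[of y] l pos[of y] by (intro divide_right_mono mult_left_mono) auto
      also have "\<dots> = l" using pos[of y] by simp
      finally show ?thesis .
    qed
    ultimately have "ereal c \<le> ereal l" using slope[OF fy] by (meson ereal_less_eq(3) order_trans)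
    then show False using l by simp
  qed
  ultimately show ?thesis by blast
qed

section \<open>The global error bound\<close>

theorem theorem4:
  fixes f :: "real ^ 'n \<Rightarrow> real" and S :: "(real ^ 'n) set"
  assumes "continuous_on UNIV f"
    and "semialgebraic_function f"
    and "good_at_infinity f"
    and S_def: "S = {x. f x \<le> 0}"
    and "S \<noteq> {}"
  shows "\<exists>c \<alpha>. c > 0 \<and> \<alpha> > 0 \<and>
    (\<forall>x. c * infdist x S \<le> max (f x) 0 powr \<alpha> + max (f x) 0)"
proof -
  obtain c R where cR: "c > 0" "R > 0"
    "\<And>x. f x > 0 \<Longrightarrow> R \<le> norm x \<Longrightarrow> ereal c \<le> nonsmooth_slope f x"
    using assms(3) unfolding good_at_infinity_def by blast
  obtain C \<alpha> where C: "C > 0" "\<alpha> > 0"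
    "\<And>x. norm x \<le> R \<Longrightarrow> infdist x S \<le> C * (max (f x) 0 powr \<alpha> + max (f x) 0)"
    using error_bound_on_ball[OF assms(1,2), of R] assms(5) cR(2) unfolding S_def by auto
  define B where "B = C + 4 / c"
  have B: "B > 0" using C(1) cR(1) by (simp add: B_def add_pos_pos)
  have "infdist x S \<le> B * (max (f x) 0 powr \<alpha> + max (f x) 0)" for x
  proof (cases "f x \<le> 0")
    case True
    then have "infdist x S = 0" by (simp add: S_def)
    then show ?thesis using B by simp
  next
    case False
    then have fx: "0 < f x" by simp
    obtain y where y: "c / 2 * dist x y \<le> 2 * f x" "f y \<le> f x" "f y \<le> 0 \<or> norm y < R"
      using descent_to_zero_set_or_ball[OF assms(1) cR(3), where l = "c / 2" and x = x] cR(1) fx by auto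
    have "infdist y S \<le> C * (max (f x) 0 powr \<alpha> + max (f x) 0)"
      using y(3)
    proof
      assume "f y \<le> 0"
      then have "infdist y S = 0" by (simp add: S_def)
      then show ?thesis using C(1) by simp
    next
      assume "norm y < R"
      then have "infdist y S \<le> C * (max (f y) 0 powr \<alpha> + max (f y) 0)" using C(3) by simp
      also have "\<dots> \<le> C * (max (f x) 0 powr \<alpha> + max (f x) 0)"
        using C(1,2) y(2) by (intro mult_left_mono add_mono powr_mono2) auto
      finally show ?thesis .
    qed
    moreover have "dist x y \<le> 4 / c * (max (f x) 0 powr \<alpha> + max (f x) 0)"
    proof -
      have "dist x y \<le> 4 / c * f x" using y(1) cR(1) by (simp add: field_simps)
      also have "\<dots> \<le> 4 / c * (max (f x) 0 powr \<alpha> + max (f x) 0)"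
        using cR(1) fx by (intro mult_left_mono) (auto simp: max_def)
      finally show ?thesis .
    qed
    ultimately show ?thesis using infdist_triangle[of x S y] by (simp add: B_def distrib_right)
  qed
  then have "\<forall>x. 1 / B * infdist x S \<le> max (f x) 0 powr \<alpha> + max (f x) 0"
    using B by (simp add: field_simps)
  then show ?thesis using B C(2) by (intro exI[of _ "1 / B"] exI[of _ \<alpha>]) auto
qed

end
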